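(* Let $c>0$ and $\lambda>0$. The mean hyperbolic distance of the center of mass, $u(t)=E\{\cosh\eta_{cm}(t)\}$ (defined in the context), given by $$u(t)=\frac{2^3 c^2 e^{-\frac{3}{4}\lambda t}}{\sqrt{\lambda^2+16 c^2}} \left\{ \frac{e^{-\frac{t}{4} \sqrt{\lambda^2+16c^2}}}{3 \sqrt{\lambda^2+16c^2}+5 \lambda}+\frac{e^{\frac{t}{4}\sqrt{\lambda^2+16c^2}}}{3 \sqrt{\lambda^2+16c^2}-5 \lambda} \right\}+ \frac{\lambda+2c}{2(\lambda+3c)}e^{ct}+\frac{\lambda-2c}{2(\lambda-3c)}e^{-ct}$$ (where for $\lambda=3c$ the right-hand side is understood as its finite limit as $\lambda\to3c$), is the solution to the Cauchy problem $$\begin{cases}\dfrac{\mathrm{d}^2}{\mathrm{d}t^2} u -c^2 u=\dfrac{\lambda c^2 e^{-\frac{3}{4}\lambda t} }{\sqrt{\lambda^2+16 c^2}} \left\{e^{-\frac{t}{4} \sqrt{\lambda^2+16 c^2}} -e^{\frac{t}{4} \sqrt{\lambda^2+16 c^2}} \right\},\\[2mm] u(0)=1,\\[1mm] \left.\dfrac{\mathrm{d}}{\mathrm{d}t}u(t)\right|_{t=0}=0.\end{cases}$$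
   Context: Here $c$ and $\lambda$ are real constants and $t\ge 0$ is the real time variable. Let $N(t)$ be a homogeneous Poisson process of rate $\lambda$ with successive event times $0<S_1<S_2<\cdots$, and set $S_0=0$. For $0\le k\le N(t)$ define $\eta_k(t)\ge 0$ by $$\cosh\eta_k(t)=\cosh c(t-S_k)\prod_{j=1}^{k}\cosh c(S_j-S_{j-1})$$ (empty product equal to $1$); this is the hyperbolic distance from the origin of the $k$-th particle in a branching system of particles moving with constant hyperbolic velocity $c$ along geodesics of the hyperbolic plane. The hyperbolic distance $\eta_{cm}(t)\ge 0$ of the center of mass is defined by $$\cosh\eta_{cm}(t)=\sum_{k=0}^{N(t)-1}\frac{1}{2^{k+1}}\cosh\eta_k(t)+\frac{1}{2^{N(t)}}\cosh\eta_{N(t)}(t),$$ where the first sum is $0$ if $N(t)=0$. *)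

theory Defs
  imports "HOL-Probability.Probability"
begin

text \<open>
  A homogeneous Poisson process on \<open>[0, \<infinity>)\<close>: the counting process \<open>N\<close> of the event times
  \<open>0 < S\<^sub>1 < S\<^sub>2 < \<dots>\<close> (with \<open>S\<^sub>0 = 0\<close>, which is not itself an event), having independent
  increments that are Poisson distributed with mean proportional to the length of the interval.
  Since the event times tend to infinity, the set counted by \<open>N t \<omega>\<close> is finite, and as \<open>N\<close> is
  nondecreasing in time the natural-number subtractions below do not truncate.
\<close>

locale poisson_process = prob_space M
  for M :: "'a measure" and rate :: real and N :: "real \<Rightarrow> 'a \<Rightarrow> nat" and S :: "nat \<Rightarrow> 'a \<Rightarrow> real" +
  assumes rate_pos: "0 < rate"
    and event_time_0: "\<And>\<omega>. \<omega> \<in> space M \<Longrightarrow> S 0 \<omega> = 0"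
    and event_times_strict_mono: "\<And>\<omega>. \<omega> \<in> space M \<Longrightarrow> strict_mono (\<lambda>k. S k \<omega>)"
    and event_times_at_top: "\<And>\<omega>. \<omega> \<in> space M \<Longrightarrow> filterlim (\<lambda>k. S k \<omega>) at_top sequentially"
    and counts_events: "\<And>t \<omega>. 0 \<le> t \<Longrightarrow> \<omega> \<in> space M \<Longrightarrow> N t \<omega> = card {k. 1 \<le> k \<and> S k \<omega> \<le> t}"
    and random_variable_N: "\<And>t. 0 \<le> t \<Longrightarrow> random_variable (count_space UNIV) (N t)"
    and independent_increments: "\<And>n (ts :: nat \<Rightarrow> real). 0 \<le> ts 0 \<Longrightarrow> (\<forall>i<n. ts i \<le> ts (Suc i)) \<Longrightarrow>
          indep_vars (\<lambda>_. count_space UNIV) (\<lambda>i \<omega>. N (ts (Suc i)) \<omega> - N (ts i) \<omega>) {..<n}"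
    and poisson_increments: "\<And>s t. 0 \<le> s \<Longrightarrow> s < t \<Longrightarrow>
          distr M (count_space UNIV) (\<lambda>\<omega>. N t \<omega> - N s \<omega>) = measure_pmf (poisson_pmf (rate * (t - s)))"

definition eta :: "real \<Rightarrow> (nat \<Rightarrow> 'a \<Rightarrow> real) \<Rightarrow> nat \<Rightarrow> real \<Rightarrow> 'a \<Rightarrow> real" where
  "eta c S k t \<omega> =
     arcosh (cosh (c * (t - S k \<omega>)) * (\<Prod>j=1..k. cosh (c * (S j \<omega> - S (j - 1) \<omega>))))"

definition eta_cm ::
  "real \<Rightarrow> (real \<Rightarrow> 'a \<Rightarrow> nat) \<Rightarrow> (nat \<Rightarrow> 'a \<Rightarrow> real) \<Rightarrow> real \<Rightarrow> 'a \<Rightarrow> real" where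
  "eta_cm c N S t \<omega> =
     arcosh ((\<Sum>k<N t \<omega>. 1 / 2 ^ (k + 1) * cosh (eta c S k t \<omega>))
             + 1 / 2 ^ N t \<omega> * cosh (eta c S (N t \<omega>) t \<omega>))"

text \<open>
  Both arguments of \<^const>\<open>arcosh\<close> are at least 1, so the two quantities are the nonnegative
  solutions of the equations that define them.
\<close>

lemma eta_nonneg: "0 \<le> eta c S k t \<omega>"
  and cosh_eta: "cosh (eta c S k t \<omega>) =
        cosh (c * (t - S k \<omega>)) * (\<Prod>j=1..k. cosh (c * (S j \<omega> - S (j - 1) \<omega>)))"
proof -
  have "1 \<le> (\<Prod>j=1..k. cosh (c * (S j \<omega> - S (j - 1) \<omega>)))"
    by (intro prod_ge_1 cosh_real_ge_1)
  hence ge: "1 \<le> cosh (c * (t - S k \<omega>)) * (\<Prod>j=1..k. cosh (c * (S j \<omega> - S (j - 1) \<omega>)))"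
    using mult_mono[of 1 "cosh (c * (t - S k \<omega>))" 1] cosh_real_ge_1[of "c * (t - S k \<omega>)"] by force
  show "0 \<le> eta c S k t \<omega>"
    unfolding eta_def by (rule arcosh_nonneg_real[OF ge])
  show "cosh (eta c S k t \<omega>) =
        cosh (c * (t - S k \<omega>)) * (\<Prod>j=1..k. cosh (c * (S j \<omega> - S (j - 1) \<omega>)))"
    unfolding eta_def by (rule cosh_arcosh_real[OF ge])
qed

lemma eta_cm_nonneg: "0 \<le> eta_cm c N S t \<omega>"
  and cosh_eta_cm: "cosh (eta_cm c N S t \<omega>) =
        (\<Sum>k<N t \<omega>. 1 / 2 ^ (k + 1) * cosh (eta c S k t \<omega>))
        + 1 / 2 ^ N t \<omega> * cosh (eta c S (N t \<omega>) t \<omega>)"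
proof -
  have weights: "(\<Sum>k<n. 1 / 2 ^ (k + 1)) + 1 / 2 ^ n = (1 :: real)" for n :: nat
    by (induction n) (auto simp: field_simps)
  have "(\<Sum>k<N t \<omega>. 1 / 2 ^ (k + 1)) + 1 / 2 ^ N t \<omega>
      \<le> (\<Sum>k<N t \<omega>. 1 / 2 ^ (k + 1) * cosh (eta c S k t \<omega>))
        + 1 / 2 ^ N t \<omega> * cosh (eta c S (N t \<omega>) t \<omega>)"
    by (intro add_mono sum_mono) (simp_all add: divide_simps cosh_real_ge_1)
  hence ge: "1 \<le> (\<Sum>k<N t \<omega>. 1 / 2 ^ (k + 1) * cosh (eta c S k t \<omega>))
        + 1 / 2 ^ N t \<omega> * cosh (eta c S (N t \<omega>) t \<omega>)"
    by (simp only: weights)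
  show "0 \<le> eta_cm c N S t \<omega>"
    unfolding eta_cm_def by (rule arcosh_nonneg_real[OF ge])
  show "cosh (eta_cm c N S t \<omega>) =
        (\<Sum>k<N t \<omega>. 1 / 2 ^ (k + 1) * cosh (eta c S k t \<omega>))
        + 1 / 2 ^ N t \<omega> * cosh (eta c S (N t \<omega>) t \<omega>)"
    unfolding eta_cm_def by (rule cosh_arcosh_real[OF ge])
qed

definition mean_cosh_cm ::
  "'a measure \<Rightarrow> real \<Rightarrow> (real \<Rightarrow> 'a \<Rightarrow> nat) \<Rightarrow> (nat \<Rightarrow> 'a \<Rightarrow> real) \<Rightarrow> real \<Rightarrow> real" where
  "mean_cosh_cm M c N S t = (\<integral>\<omega>. cosh (eta_cm c N S t \<omega>) \<partial>M)"

text \<open>For \<open>lam = 3 * c\<close> two of the denominators below vanish.\<close>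

definition u_formula :: "real \<Rightarrow> real \<Rightarrow> real \<Rightarrow> real" where
  "u_formula c lam t =
     2 ^ 3 * c\<^sup>2 * exp (- (3 / 4) * lam * t) / sqrt (lam\<^sup>2 + 16 * c\<^sup>2)
       * (exp (- (t / 4) * sqrt (lam\<^sup>2 + 16 * c\<^sup>2)) / (3 * sqrt (lam\<^sup>2 + 16 * c\<^sup>2) + 5 * lam)
          + exp (t / 4 * sqrt (lam\<^sup>2 + 16 * c\<^sup>2)) / (3 * sqrt (lam\<^sup>2 + 16 * c\<^sup>2) - 5 * lam))
     + (lam + 2 * c) / (2 * (lam + 3 * c)) * exp (c * t)
     + (lam - 2 * c) / (2 * (lam - 3 * c)) * exp (- c * t)"

text \<open>
  The Cauchy problem on \<open>[0, \<infinity>)\<close>; \<open>v'\<close> and \<open>v''\<close> are the first two derivatives of \<open>v\<close>,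
  one-sided at \<open>t = 0\<close>.
\<close>

definition solves_cauchy_problem :: "real \<Rightarrow> real \<Rightarrow> (real \<Rightarrow> real) \<Rightarrow> bool" where
  "solves_cauchy_problem c lam v \<longleftrightarrow>
     (\<exists>v' v''.
        (\<forall>t\<ge>0. (v has_real_derivative v' t) (at t within {0..})) \<and>
        (\<forall>t\<ge>0. (v' has_real_derivative v'' t) (at t within {0..})) \<and>
        (\<forall>t\<ge>0. v'' t - c\<^sup>2 * v t =
           lam * c\<^sup>2 * exp (- (3 / 4) * lam * t) / sqrt (lam\<^sup>2 + 16 * c\<^sup>2)
             * (exp (- (t / 4) * sqrt (lam\<^sup>2 + 16 * c\<^sup>2)) - exp (t / 4 * sqrt (lam\<^sup>2 + 16 * c\<^sup>2)))) \<and>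
        v 0 = 1 \<and> v' 0 = 0)"

end

theory Submission
  imports Defs
begin

text \<open>
  Let \<open>C\<close> and \<open>D\<close> be the means of the last summand of \<open>cosh \<eta>\<^sub>c\<^sub>m\<close> and of the same expression with
  \<open>sinh (c * (t - S n))\<close> in place of \<open>cosh (c * (t - S n))\<close>, and let \<open>Z\<close> and \<open>W\<close> be the corresponding
  means of the whole sum. Conditioning on the events in a short time interval gives the linear system
  \<open>C' = c D - (\<lambda>/2) C\<close>, \<open>D' = c C - \<lambda> D\<close>, \<open>Z' = c W\<close>, \<open>W' = c Z - (\<lambda>/2) D\<close>. Its first half
  determines \<open>D\<close>, and its second half is the equation \<open>Z'' - c\<^sup>2 Z = - (\<lambda> c/2) D\<close> of the Cauchy
  problem. The underlying random variables are bounded by \<open>exp (c t)\<close>, since \<open>cosh y \<le> exp y\<close> for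
  \<open>y \<ge> 0\<close>; hence they are integrable and the error terms are uniform.
\<close>

section \<open>Distances along a sequence of event times\<close>

text \<open>The process is described through increments of \<open>N\<close> at finitely many
  deterministic times; neither measurability of the \<open>S j\<close> nor a joint law of the
  waiting times is given. Conditioning on the past therefore takes the form of a product formula,
  for a functional of the past times an indicator of the next increment. Conditioning happens at the
  earlier of two times, so it yields forward estimates only. Turning them into derivatives requires
  continuity of the means, which is itself drawn from these estimates and the uniform bounds. The
  closed formula is not obtained by integrating the system: it is checked to solve the Cauchy
  problem and identified with the mean by uniqueness.\<close>

definition leg_prod :: "real \<Rightarrow> (nat \<Rightarrow> real) \<Rightarrow> nat \<Rightarrow> real" where
  "leg_prod c x k = (\<Prod>j=1..k. cosh (c * (x j - x (j - 1))))"

text \<open>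
  With \<open>n\<close> the number of events up to time \<open>t\<close> and \<open>x\<close> the sequence of event times, the \<^const>\<open>cosh\<close>
  versions are the last summand and the whole of \<open>cosh \<eta>\<^sub>c\<^sub>m\<close>. The \<^const>\<open>sinh\<close> versions are their time
  derivatives between events, divided by \<open>c\<close>.
\<close>

definition last_term :: "(real \<Rightarrow> real) \<Rightarrow> real \<Rightarrow> nat \<Rightarrow> (nat \<Rightarrow> real) \<Rightarrow> real \<Rightarrow> real" where
  "last_term f c n x t = f (c * (t - x n)) * leg_prod c x n / 2 ^ n"

definition cm_term :: "(real \<Rightarrow> real) \<Rightarrow> real \<Rightarrow> nat \<Rightarrow> (nat \<Rightarrow> real) \<Rightarrow> real \<Rightarrow> real" where
  "cm_term f c n x t =
     (\<Sum>k<n. f (c * (t - x k)) * leg_prod c x k / 2 ^ (k + 1)) + last_term f c n x t"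

lemma leg_prod_0 [simp]: "leg_prod c x 0 = 1"
  by (simp add: leg_prod_def)

lemma leg_prod_Suc: "leg_prod c x (Suc k) = cosh (c * (x (Suc k) - x k)) * leg_prod c x k"
  by (simp add: leg_prod_def mult.commute)

lemma leg_prod_pos: "0 < leg_prod c x k"
  unfolding leg_prod_def by (intro prod_pos) simp

section \<open>Exponential bounds, uniform in the number of events\<close>

lemma cosh_le_exp: "0 \<le> y \<Longrightarrow> cosh y \<le> exp y" for y :: real
  using exp_le_cancel_iff[of "-y" y] by (simp add: cosh_def del: exp_le_cancel_iff)

lemma abs_sinh_le_cosh: "\<bar>sinh y\<bar> \<le> cosh y" for y :: real
  by (simp add: sinh_def cosh_def abs_le_iff)

text \<open>Each leg contributes at most the exponential of its length, and the lengths add up to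
  \<open>c * x k\<close> because \<open>x 0 = 0\<close>.\<close>

lemma leg_prod_le_exp:
  assumes "0 \<le> c" "mono x" "x 0 = 0"
  shows "leg_prod c x k \<le> exp (c * x k)"
proof (induction k)
  case (Suc k)
  have "x k \<le> x (Suc k)" using assms(2) by (simp add: monoD)
  then have "cosh (c * (x (Suc k) - x k)) \<le> exp (c * (x (Suc k) - x k))"
    using assms(1) by (intro cosh_le_exp) simp
  then have "leg_prod c x (Suc k) \<le> exp (c * (x (Suc k) - x k)) * exp (c * x k)"
    unfolding leg_prod_Suc using Suc leg_prod_pos[of c x k] by (intro mult_mono) auto
  then show ?case by (simp flip: exp_add add: algebra_simps)
qed (use assms in simp)

lemma cosh_leg_prod_le_exp:
  assumes "0 \<le> c" "mono x" "x 0 = 0" "x k \<le> t"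
  shows "cosh (c * (t - x k)) * leg_prod c x k \<le> exp (c * t)"
proof -
  have "cosh (c * (t - x k)) * leg_prod c x k \<le> exp (c * (t - x k)) * exp (c * x k)"
    using assms leg_prod_pos[of c x k] leg_prod_le_exp[OF assms(1-3), of k]
    by (intro mult_mono cosh_le_exp) auto
  then show ?thesis by (simp flip: exp_add add: algebra_simps)
qed

lemma weights_sum: "(\<Sum>k<n. 1 / 2 ^ (k + 1)) + 1 / 2 ^ n = (1 :: real)" for n :: nat
  by (induction n) (auto simp: field_simps)

text \<open>The weights add up to 1, so a bound common to all summands passes to the sum, whatever
  \<open>n\<close> is.\<close>

lemma cm_term_cosh_le_exp:
  assumes "0 \<le> c" "mono x" "x 0 = 0" "x n \<le> t"
  shows "cm_term cosh c n x t \<le> exp (c * t)"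
proof -
  have *: "cosh (c * (t - x k)) * leg_prod c x k \<le> exp (c * t)" if "k \<le> n" for k
    using assms monoD[OF assms(2) that] by (intro cosh_leg_prod_le_exp) auto
  have "cm_term cosh c n x t \<le> (\<Sum>k<n. exp (c * t) / 2 ^ (k + 1)) + exp (c * t) / 2 ^ n"
    unfolding cm_term_def last_term_def using * by (intro add_mono sum_mono divide_right_mono) auto
  also have "\<dots> = exp (c * t) * ((\<Sum>k<n. 1 / 2 ^ (k + 1)) + 1 / 2 ^ n)"
    unfolding distrib_left sum_distrib_left by simp
  finally show ?thesis unfolding weights_sum by simp
qed

lemma last_term_cosh_nonneg: "0 \<le> last_term cosh c n x t"
  unfolding last_term_def using leg_prod_pos[of c x n] by simp

lemma abs_last_term_sinh_le: "\<bar>last_term sinh c n x t\<bar> \<le> last_term cosh c n x t"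
  unfolding last_term_def using leg_prod_pos[of c x n] abs_sinh_le_cosh[of "c * (t - x n)"]
  by (simp add: abs_mult divide_right_mono mult_right_mono)

lemma last_term_cosh_le_cm_term: "last_term cosh c n x t \<le> cm_term cosh c n x t"
  unfolding cm_term_def using leg_prod_pos[of c x] by (simp add: sum_nonneg less_imp_le)

lemma abs_cm_term_sinh_le: "\<bar>cm_term sinh c n x t\<bar> \<le> cm_term cosh c n x t"
  unfolding cm_term_def
proof (intro order_trans[OF abs_triangle_ineq] add_mono order_trans[OF sum_abs] sum_mono)
  show "\<bar>sinh (c * (t - x k)) * leg_prod c x k / 2 ^ (k + 1)\<bar>
      \<le> cosh (c * (t - x k)) * leg_prod c x k / 2 ^ (k + 1)" for k
    using leg_prod_pos[of c x k] abs_sinh_le_cosh[of "c * (t - x k)"]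
    by (simp add: abs_mult divide_right_mono mult_right_mono)
qed (rule abs_last_term_sinh_le)

text \<open>With \<open>n\<close> and the event times frozen, the cosh and sinh versions undergo a
  hyperbolic rotation through \<open>c * h\<close>, by the addition theorems. This is the exact
  motion while no event occurs.\<close>

lemma last_term_flow:
  shows "last_term cosh c n x (s + h) =
      cosh (c * h) * last_term cosh c n x s + sinh (c * h) * last_term sinh c n x s"
    and "last_term sinh c n x (s + h) =
      cosh (c * h) * last_term sinh c n x s + sinh (c * h) * last_term cosh c n x s"
proof -
  have *: "c * (s + h - x n) = c * h + c * (s - x n)" by (simp add: algebra_simps)
  show "last_term cosh c n x (s + h) =
      cosh (c * h) * last_term cosh c n x s + sinh (c * h) * last_term sinh c n x s"
    "last_term sinh c n x (s + h) =
      cosh (c * h) * last_term sinh c n x s + sinh (c * h) * last_term cosh c n x s"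
    unfolding last_term_def * cosh_add sinh_add by (simp_all add: distrib_right add_divide_distrib mult.assoc)
qed

lemma cm_term_flow:
  shows "cm_term cosh c n x (s + h) =
      cosh (c * h) * cm_term cosh c n x s + sinh (c * h) * cm_term sinh c n x s"
    and "cm_term sinh c n x (s + h) =
      cosh (c * h) * cm_term sinh c n x s + sinh (c * h) * cm_term cosh c n x s"
proof -
  have *: "c * (s + h - x k) = c * h + c * (s - x k)" for k by (simp add: algebra_simps)
  show "cm_term cosh c n x (s + h) =
      cosh (c * h) * cm_term cosh c n x s + sinh (c * h) * cm_term sinh c n x s"
    "cm_term sinh c n x (s + h) =
      cosh (c * h) * cm_term sinh c n x s + sinh (c * h) * cm_term cosh c n x s"
    unfolding cm_term_def last_term_flow * cosh_add sinh_add
    by (simp_all add: sum_distrib_left sum.distrib distrib_right distrib_left add_divide_distrib mult.assoc)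
qed

section \<open>Short-time estimates for the motion and for one event\<close>

lemma cosh_sinh_taylor:
  fixes y :: real assumes "0 \<le> y" "y \<le> 1"
  shows "\<bar>cosh y - 1\<bar> \<le> y\<^sup>2" "\<bar>sinh y - y\<bar> \<le> y\<^sup>2" "exp y - 1 \<le> 2 * y"
proof -
  \<comment> \<open>Here \<open>p\<close>, \<open>q\<close>, \<open>z\<close> stand for
    \<open>exp y\<close>, \<open>exp (-y)\<close>, \<open>y\<^sup>2\<close>, which makes both
    estimates linear.\<close>
  have aux: "\<bar>(p + q) / 2 - 1\<bar> \<le> z \<and> \<bar>(p - q) / 2 - y\<bar> \<le> z"
    if "1 + y \<le> p" "1 - y \<le> q" "p \<le> 1 + y + z" "q \<le> 1 - y + z" for p q z
    using that assms by (auto simp: abs_le_iff field_simps)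
  have e1: "1 + y \<le> exp y" "exp y \<le> 1 + y + y\<^sup>2"
    using exp_ge_add_one_self[of y] exp_bound[OF assms] by auto
  have y2: "y\<^sup>2 \<le> y" using assms by (simp add: power2_eq_square mult_left_le)
  have "exp (-y) \<le> 1 - y + y\<^sup>2"
  proof -
    \<comment> \<open>The product equals \<open>1 + y ^ 3\<close>; it turns the lower bound on
      \<open>exp y\<close> into an upper bound on \<open>exp (-y)\<close>.\<close>
    have "1 \<le> (1 + y) * (1 - y + y\<^sup>2)" using assms by (simp add: algebra_simps power2_eq_square)
    also have "\<dots> \<le> exp y * (1 - y + y\<^sup>2)"
      using assms e1 by (intro mult_right_mono) auto
    finally show ?thesis by (simp add: exp_minus field_simps)
  qed
  moreover have "1 - y \<le> exp (-y)" using exp_ge_add_one_self[of "-y"] by simp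
  ultimately show "\<bar>cosh y - 1\<bar> \<le> y\<^sup>2" "\<bar>sinh y - y\<bar> \<le> y\<^sup>2"
    using aux[OF e1(1) _ e1(2)] unfolding cosh_field_def sinh_field_def by auto
  show "exp y - 1 \<le> 2 * y" using e1 y2 by simp
qed

lemma abs_flow_le:
  fixes p q :: real
  assumes "0 \<le> y" "y \<le> 1" "\<bar>p\<bar> \<le> B" "\<bar>q\<bar> \<le> B"
  shows "\<bar>cosh y * p + sinh y * q - p - y * q\<bar> \<le> 2 * B * y\<^sup>2"
proof -
  have "cosh y * p + sinh y * q - p - y * q = (cosh y - 1) * p + (sinh y - y) * q"
    by (simp add: algebra_simps)
  also have "\<bar>\<dots>\<bar> \<le> \<bar>cosh y - 1\<bar> * \<bar>p\<bar> + \<bar>sinh y - y\<bar> * \<bar>q\<bar>"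
    by (metis abs_mult abs_triangle_ineq)
  also have "\<dots> \<le> y\<^sup>2 * B + y\<^sup>2 * B"
    using cosh_sinh_taylor[OF assms(1,2)] assms by (intro add_mono mult_mono) auto
  finally show ?thesis by simp
qed

lemma cosh_shift_bounds:
  fixes b d :: real assumes "0 \<le> b" "0 \<le> d"
  shows "cosh b \<le> cosh (b + d)" "cosh (b + d) \<le> exp d * cosh b"
    "sinh b \<le> sinh (b + d)" "sinh (b + d) - sinh b \<le> (exp d - 1) * cosh b"
proof -
  have e: "exp (-b - d) \<le> exp (d - b)" "1 \<le> exp d" "exp (-d) \<le> 1" using assms by auto
  show "cosh b \<le> cosh (b + d)" using assms by (subst cosh_real_nonneg_le_iff) auto
  show "sinh b \<le> sinh (b + d)" using assms by simp
  show "cosh (b + d) \<le> exp d * cosh b"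
    using e by (simp add: cosh_def distrib_left flip: exp_add) (simp add: algebra_simps)
  \<comment> \<open>After cancelling the \<open>exp b\<close> parts, this is all that the sinh bound
    still requires; it holds because \<open>1 - exp (-d) \<le> d \<le> exp d - 1\<close>.\<close>
  have "exp (-b) * (1 - exp (-d)) \<le> exp (-b) * (exp d - 1)"
    using exp_ge_add_one_self[of d] exp_ge_add_one_self[of "-d"]
    by (intro mult_left_mono) (linarith | simp)+
  moreover have "exp (- (b + d)) = exp (-b) * exp (-d)" by (simp flip: exp_add)
  ultimately show "sinh (b + d) - sinh b \<le> (exp d - 1) * cosh b"
    unfolding sinh_field_def cosh_field_def exp_add[of b d] by (simp add: field_simps)
qed

text \<open>Here \<open>b\<close> is the hyperbolic length run from the last event to
  \<open>s\<close>, \<open>d\<close> the length from \<open>s\<close> to the new event and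
  \<open>a\<close> the length from there to \<open>t\<close>. The error depends only on
  \<open>a + d = c * (t - s)\<close>, not on where in the interval the event falls.\<close>

lemma jump_bound:
  fixes b d a y :: real assumes "0 \<le> a" "0 \<le> b" "0 \<le> d" "a + d = y"
  shows "\<bar>cosh a * cosh (b + d) - cosh b\<bar> \<le> (exp y - 1) * cosh b"
    "\<bar>sinh a * cosh (b + d)\<bar> \<le> (exp y - 1) * cosh b"
proof -
  note B = cosh_shift_bounds[OF assms(2,3)]
  have ey: "exp y = exp a * exp d" using assms(4) by (auto simp flip: exp_add)
  have "cosh a * cosh (b + d) \<le> exp a * (exp d * cosh b)"
    using B cosh_le_exp[OF assms(1)] by (intro mult_mono) auto
  moreover have "1 * cosh b \<le> cosh a * cosh (b + d)"
    using B cosh_real_ge_1[of a] by (intro mult_mono) auto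
  ultimately show "\<bar>cosh a * cosh (b + d) - cosh b\<bar> \<le> (exp y - 1) * cosh b"
    using B unfolding ey by (auto simp: algebra_simps)
  have "sinh a \<le> exp a - 1"
    using cosh_real_ge_1[of a] cosh_plus_sinh[of a] by linarith
  then have "sinh a * cosh (b + d) \<le> (exp a - 1) * (exp d * cosh b)"
    using B assms(1) by (intro mult_mono) auto
  also have "\<dots> \<le> (exp y - 1) * cosh b"
  proof -
    have "(exp a - 1) * exp d \<le> exp y - 1" unfolding ey using assms(3) by (simp add: algebra_simps)
    then show ?thesis using mult_right_mono[of "(exp a - 1) * exp d" "exp y - 1" "cosh b"] by simp
  qed
  finally show "\<bar>sinh a * cosh (b + d)\<bar> \<le> (exp y - 1) * cosh b"
    using assms(1) by (simp add: abs_mult)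
qed

section \<open>Effect of a single event in \<open>[s, t]\<close>\<close>

context
  fixes c :: real and x :: "nat \<Rightarrow> real" and n :: nat and s t :: real
  assumes c: "0 \<le> c" and x: "mono x" "x n \<le> s" "s \<le> x (Suc n)" "x (Suc n) \<le> t"
begin

private lemma leg: "k \<le> n \<Longrightarrow> 0 \<le> c * (s - x k)" "s \<le> t" "0 \<le> c * (t - x (Suc n))"
  "0 \<le> c * (x (Suc n) - s)" "0 \<le> c * (t - s)"
  using c x monoD[OF x(1), of k n] by auto

private lemma split_leg:
  "c * (x (Suc n) - x n) = c * (s - x n) + c * (x (Suc n) - s)"
  "c * (t - x k) = c * (s - x k) + c * (t - s)"
  by (simp_all add: algebra_simps)

private lemma jump:
  "\<bar>cosh (c * (t - x (Suc n))) * cosh (c * (x (Suc n) - x n)) - cosh (c * (s - x n))\<bar>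
     \<le> (exp (c * (t - s)) - 1) * cosh (c * (s - x n))"
  "\<bar>sinh (c * (t - x (Suc n))) * cosh (c * (x (Suc n) - x n))\<bar>
     \<le> (exp (c * (t - s)) - 1) * cosh (c * (s - x n))"
  using jump_bound[OF leg(3) leg(1)[of n] leg(4), of "c * (t - s)"]
  unfolding split_leg(1) by (simp_all add: algebra_simps)

private lemma keep:
  assumes "k \<le> n"
  shows "\<bar>cosh (c * (t - x k)) - cosh (c * (s - x k))\<bar>
     \<le> (exp (c * (t - s)) - 1) * cosh (c * (s - x k))"
  "\<bar>sinh (c * (t - x k)) - sinh (c * (s - x k))\<bar>
     \<le> (exp (c * (t - s)) - 1) * cosh (c * (s - x k))"
  using cosh_shift_bounds[OF leg(1)[OF assms] leg(5)]
  unfolding split_leg(2) by (auto simp: algebra_simps)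

lemma last_term_jump:
  "\<bar>last_term cosh c (Suc n) x t - last_term cosh c n x s / 2\<bar>
     \<le> (exp (c * (t - s)) - 1) * last_term cosh c n x s"
  "\<bar>last_term sinh c (Suc n) x t\<bar> \<le> (exp (c * (t - s)) - 1) * last_term cosh c n x s"
proof -
  \<comment> \<open>The weight after the event, so the last term at time \<open>s\<close> carries
    \<open>2 * w\<close>; this is the source of the halving. The estimates below come with
    \<open>w\<close> where the claims allow \<open>2 * w\<close>, and \<open>e\<close> covers the
    difference.\<close>
  define w where "w = leg_prod c x n / 2 ^ Suc n"
  have w: "0 \<le> w" using leg_prod_pos[of c x n] by (simp add: w_def)
  have W: "last_term cosh c n x s = cosh (c * (s - x n)) * (2 * w)"
    "last_term f c (Suc n) x t = f (c * (t - x (Suc n))) * cosh (c * (x (Suc n) - x n)) * w" for f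
    by (simp_all add: last_term_def w_def leg_prod_Suc)
  have e: "0 \<le> (exp (c * (t - s)) - 1) * cosh (c * (s - x n)) * w" using leg w by simp
  have "\<bar>(cosh (c * (t - x (Suc n))) * cosh (c * (x (Suc n) - x n)) - cosh (c * (s - x n))) * w\<bar>
     \<le> (exp (c * (t - s)) - 1) * cosh (c * (s - x n)) * w"
    using jump(1) w by (simp add: abs_mult mult_right_mono)
  then show "\<bar>last_term cosh c (Suc n) x t - last_term cosh c n x s / 2\<bar>
     \<le> (exp (c * (t - s)) - 1) * last_term cosh c n x s"
    using e unfolding W by (simp add: algebra_simps)
  have "\<bar>(sinh (c * (t - x (Suc n))) * cosh (c * (x (Suc n) - x n))) * w\<bar>
     \<le> (exp (c * (t - s)) - 1) * cosh (c * (s - x n)) * w"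
    using jump(2) w by (simp add: abs_mult mult_right_mono)
  then show "\<bar>last_term sinh c (Suc n) x t\<bar> \<le> (exp (c * (t - s)) - 1) * last_term cosh c n x s"
    using e unfolding W by (simp add: algebra_simps)
qed

lemma cm_term_jump:
  "\<bar>cm_term cosh c (Suc n) x t - cm_term cosh c n x s\<bar>
     \<le> (exp (c * (t - s)) - 1) * cm_term cosh c n x s"
  "\<bar>cm_term sinh c (Suc n) x t - (cm_term sinh c n x s - last_term sinh c n x s / 2)\<bar>
     \<le> (exp (c * (t - s)) - 1) * cm_term cosh c n x s"
proof -
  let ?e = "exp (c * (t - s)) - 1"
  define w where "w k = leg_prod c x k / 2 ^ (k + 1)" for k
  have w: "0 \<le> w k" for k using leg_prod_pos[of c x k] by (simp add: w_def)
  \<comment> \<open>The last term is kept as two equal halves. At the event one half becomes the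
    summand with index \<open>n\<close> and moves on continuously, while the other becomes the new
    last term and starts a fresh leg.\<close>
  have L: "last_term f c n x r = f (c * (r - x n)) * w n + f (c * (r - x n)) * w n" for f r
    by (simp add: last_term_def w_def)
  have C: "cm_term f c n x s =
      (\<Sum>k<n. f (c * (s - x k)) * w k) + (f (c * (s - x n)) * w n + f (c * (s - x n)) * w n)" for f
    unfolding cm_term_def L by (simp add: w_def)
  have L1: "last_term f c (Suc n) x t = f (c * (t - x (Suc n))) * cosh (c * (x (Suc n) - x n)) * w n" for f
    by (simp add: last_term_def w_def leg_prod_Suc)
  have C1: "cm_term f c (Suc n) x t = (\<Sum>k<n. f (c * (t - x k)) * w k) + (f (c * (t - x n)) * w n +
     f (c * (t - x (Suc n))) * cosh (c * (x (Suc n) - x n)) * w n)" for f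
    unfolding cm_term_def L1 by (simp add: w_def)
  have term_le: "\<bar>p * w k - q * w k\<bar> \<le> ?e * (r * w k)" if "\<bar>p - q\<bar> \<le> ?e * r" for p q r k
    using mult_right_mono[OF that w[of k]] w[of k]
    by (simp add: abs_mult mult.assoc flip: left_diff_distrib)
  have sum_le: "\<bar>(\<Sum>k<n. f (c * (t - x k)) * w k) - (\<Sum>k<n. f (c * (s - x k)) * w k)\<bar>
      \<le> ?e * (\<Sum>k<n. cosh (c * (s - x k)) * w k)"
    if "\<And>k. k \<le> n \<Longrightarrow> \<bar>f (c * (t - x k)) - f (c * (s - x k))\<bar> \<le> ?e * cosh (c * (s - x k))" for f
    unfolding sum_subtractf[symmetric] sum_distrib_left
    by (intro order_trans[OF sum_abs] sum_mono term_le that) auto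
  note t1 = sum_le[of cosh, OF keep(1)] term_le[OF keep(1)[OF order_refl], of n] term_le[OF jump(1), of n]
  show "\<bar>cm_term cosh c (Suc n) x t - cm_term cosh c n x s\<bar> \<le> ?e * cm_term cosh c n x s"
    using t1 unfolding C C1 distrib_left by linarith
  show "\<bar>cm_term sinh c (Suc n) x t - (cm_term sinh c n x s - last_term sinh c n x s / 2)\<bar>
     \<le> ?e * cm_term cosh c n x s"
  proof -
    have "\<bar>sinh (c * (t - x (Suc n))) * cosh (c * (x (Suc n) - x n)) * w n\<bar>
        \<le> ?e * (cosh (c * (s - x n)) * w n)"
      using term_le[of _ 0] jump(2) by simp
    moreover have "\<bar>(\<Sum>k<n. sinh (c * (t - x k)) * w k) - (\<Sum>k<n. sinh (c * (s - x k)) * w k)\<bar>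
      \<le> ?e * (\<Sum>k<n. cosh (c * (s - x k)) * w k)"
      by (intro sum_le keep(2))
    moreover note term_le[OF keep(2)[OF order_refl], of n]
    moreover have "last_term sinh c n x s / 2 = sinh (c * (s - x n)) * w n" by (simp add: L)
    ultimately show ?thesis
      unfolding C C1 distrib_left by linarith
  qed
qed

end

section \<open>Independence of the past and the next increment\<close>

lemma card_nat_less_real:
  fixes y :: real
  assumes "0 \<le> y"
  shows "{i::nat. real i < y} = {..<nat \<lceil>y\<rceil>}" "card {i::nat. real i < y} = nat \<lceil>y\<rceil>"
proof -
  show "{i::nat. real i < y} = {..<nat \<lceil>y\<rceil>}" using assms by (auto simp: zless_nat_eq_int_zless less_ceiling_iff)
  then show "card {i::nat. real i < y} = nat \<lceil>y\<rceil>" by simp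
qed

section \<open>Poisson probabilities for a small mean\<close>

lemma pmf_poisson_0_1:
  fixes r :: real assumes "0 < r"
  shows "pmf (poisson_pmf r) 0 = exp (- r)" "pmf (poisson_pmf r) 1 = r * exp (- r)"
  using assms by (simp_all add: pmf_poisson)

text \<open>The mass is \<open>1 - exp (-r) * (1 + r)\<close>, and
  \<open>exp (-r) \<ge> 1 - r\<close> turns this into at most
  \<open>1 - (1 - r) * (1 + r)\<close>.\<close>

lemma poisson_measure_ge2:
  fixes r :: real assumes "0 < r"
  shows "measure (poisson_pmf r) {2..} \<le> r\<^sup>2"
proof -
  have U: "UNIV = {2..} \<union> {0, 1::nat}" by auto
  have "1 = measure (poisson_pmf r) ({2..} \<union> {0, 1})"
    unfolding U[symmetric] by simp
  also have "\<dots> = measure (poisson_pmf r) {2..} + measure (poisson_pmf r) {0, 1}"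
    by (intro measure_pmf.finite_measure_Union) auto
  also have "measure (poisson_pmf r) {0, 1} = exp (-r) * (1 + r)"
    using assms by (simp add: measure_measure_pmf_finite pmf_poisson_0_1[simplified] algebra_simps)
  finally have eq: "measure (poisson_pmf r) {2..} = 1 - exp (-r) * (1 + r)" by simp
  have "(1 - r) * (1 + r) \<le> exp (-r) * (1 + r)"
    using exp_ge_add_one_self[of "-r"] assms by (intro mult_right_mono) auto
  then show ?thesis unfolding eq by (simp add: algebra_simps power2_eq_square)
qed

text \<open>
  Continuity in the event times lets a functional of the past be approximated by functionals of
  finitely many increments, for which independence of the future increment is an assumption.
\<close>

definition past_functional :: "real \<Rightarrow> real \<Rightarrow> (nat \<Rightarrow> (nat \<Rightarrow> real) \<Rightarrow> real) \<Rightarrow> bool" where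
  "past_functional s B F \<longleftrightarrow>
     (\<forall>n x. mono x \<longrightarrow> x 0 = 0 \<longrightarrow> x n \<le> s \<longrightarrow> \<bar>F n x\<bar> \<le> B) \<and>
     (\<forall>n x X. (\<forall>j\<le>n. (\<lambda>m. X m j) \<longlonglongrightarrow> x j) \<longrightarrow> (\<lambda>m :: nat. F n (X m)) \<longlonglongrightarrow> F n x)"

context poisson_process
begin

text \<open>The counted set is an initial segment of the positive indices, since the event times
  increase. This duality is what lets information on the \<open>S j\<close> be read off from
  \<open>N\<close>.\<close>

lemma le_N_iff:
  assumes "0 \<le> t" "\<omega> \<in> space M"
  shows "j \<le> N t \<omega> \<longleftrightarrow> S j \<omega> \<le> t"
proof -
  let ?A = "{k. 1 \<le> k \<and> S k \<omega> \<le> t}"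
  note m = event_times_strict_mono[OF assms(2)]
  obtain b where b: "\<And>k. b \<le> k \<Longrightarrow> t + 1 \<le> S k \<omega>"
    using event_times_at_top[OF assms(2)] unfolding filterlim_at_top eventually_sequentially by blast
  \<comment> \<open>Finiteness matters: on an infinite set \<open>card\<close> would return its
    default value 0.\<close>
  have "?A \<subseteq> {..b}"
  proof
    fix k assume "k \<in> ?A"
    then show "k \<in> {..b}" using b[of k] by (cases "b \<le> k") auto
  qed
  then have fin: "finite ?A" by (rule finite_subset) simp
  have down: "{1..k} \<subseteq> ?A" if "S k \<omega> \<le> t" for k
    using that strict_mono_leD[OF m, of _ k] by fastforce
  show ?thesis
  proof
    assume S: "S j \<omega> \<le> t"
    have "card {1..j} \<le> card ?A" by (rule card_mono[OF fin down[OF S]])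
    then show "j \<le> N t \<omega>" using counts_events[OF assms] by simp
  next
    assume j: "j \<le> N t \<omega>"
    show "S j \<omega> \<le> t"
    proof (rule ccontr)
      assume n: "\<not> S j \<omega> \<le> t"
      then have "0 < j" using event_time_0[OF assms(2)] assms(1) by (cases j) auto
      have "?A \<subseteq> {1..<j}"
      proof
        fix k assume "k \<in> ?A"
        then show "k \<in> {1..<j}" using n strict_mono_leD[OF m, of j k] by (cases "j \<le> k") auto
      qed
      then have "card ?A \<le> card {1..<j}" by (intro card_mono) auto
      then show False using j counts_events[OF assms] \<open>0 < j\<close> by simp
    qed
  qed
qed

lemma N_mono:
  assumes "0 \<le> s" "s \<le> t" "\<omega> \<in> space M"
  shows "N s \<omega> \<le> N t \<omega>"
proof -
  have "S (N s \<omega>) \<omega> \<le> t" using le_N_iff[of s \<omega> "N s \<omega>"] assms by auto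
  then show ?thesis using le_N_iff[of t \<omega> "N s \<omega>"] assms by auto
qed

lemma N_0:
  assumes "\<omega> \<in> space M"
  shows "N 0 \<omega> = 0"
proof -
  have "0 < S (Suc 0) \<omega>"
    using strict_monoD[OF event_times_strict_mono[OF assms], of 0 1] event_time_0[OF assms] by simp
  then show ?thesis using le_N_iff[OF order_refl assms, of "Suc 0"] by auto
qed

text \<open>Up to time \<open>s\<close>, this is \<open>S j\<close> rounded up to the grid of mesh \<open>s / m\<close>.\<close>

definition grid_time :: "real \<Rightarrow> nat \<Rightarrow> nat \<Rightarrow> 'a \<Rightarrow> real" where
  "grid_time s m j \<omega> = s / m * card {i::nat. i < m \<and> N (real i * s / m) \<omega> < j}"

text \<open>By \<open>le_N_iff\<close> the counted indices are those of the grid points strictly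
  before \<open>S j\<close>. Their number is the ceiling of \<open>m * S j \<omega> / s\<close>, so
  the rounding error is at most one mesh width.\<close>

lemma grid_time_bounds:
  assumes "0 \<le> s" "\<omega> \<in> space M" "0 < m" "S j \<omega> \<le> s"
  shows "\<bar>grid_time s m j \<omega> - S j \<omega>\<bar> \<le> s / m"
proof (cases "s = 0")
  case True
  moreover have "0 \<le> S j \<omega>"
    using strict_mono_leD[OF event_times_strict_mono[OF assms(2)], of 0 j] event_time_0[OF assms(2)]
    by simp
  ultimately show ?thesis using assms by (simp add: grid_time_def)
next
  case False
  define y where "y = m * S j \<omega> / s"
  have S0: "0 \<le> S j \<omega>"
    using strict_mono_leD[OF event_times_strict_mono[OF assms(2)], of 0 j] event_time_0[OF assms(2)]
    by simp
  have y: "0 \<le> y" "y \<le> m"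
    using assms False S0 by (auto simp: y_def field_simps)
  have "N (real i * s / m) \<omega> < j \<longleftrightarrow> real i < y" for i :: nat
  proof -
    have "N (real i * s / m) \<omega> < j \<longleftrightarrow> \<not> S j \<omega> \<le> real i * s / m"
      using le_N_iff[of "real i * s / m" \<omega> j] assms(1,2) by auto
    also have "\<dots> \<longleftrightarrow> real i < y"
      using assms(1,3) False by (simp add: not_le y_def field_simps)
    finally show ?thesis .
  qed
  \<comment> \<open>The cutoff \<open>i < m\<close> removes nothing here because
    \<open>S j \<omega> \<le> s\<close>.\<close>
  then have "{i::nat. i < m \<and> N (real i * s / m) \<omega> < j} = {i. real i < y}" using y(2) by auto
  then have "grid_time s m j \<omega> = s / m * \<lceil>y\<rceil>"
    using y card_nat_less_real(2)[OF y(1)] by (simp add: grid_time_def)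
  moreover have "S j \<omega> = s / m * y" using False assms by (simp add: y_def)
  ultimately have "\<bar>grid_time s m j \<omega> - S j \<omega>\<bar> = \<bar>s / m * (\<lceil>y\<rceil> - y)\<bar>" by (simp add: right_diff_distrib)
  also have "\<dots> = s / m * \<bar>\<lceil>y\<rceil> - y\<bar>" using assms(1) by (simp add: abs_mult)
  also have "\<dots> \<le> s / m * 1" using assms(1) by (intro mult_left_mono) (linarith, simp)
  finally show ?thesis by simp
qed

lemma grid_time_tendsto:
  assumes "0 \<le> s" "\<omega> \<in> space M" "S j \<omega> \<le> s"
  shows "(\<lambda>m. grid_time s m j \<omega>) \<longlonglongrightarrow> S j \<omega>"
proof (rule Lim_null[THEN iffD2], rule Lim_null_comparison)
  show "\<forall>\<^sub>F m in sequentially. norm (grid_time s m j \<omega> - S j \<omega>) \<le> s / real m"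
    using eventually_gt_at_top[of 0]
    by eventually_elim (use grid_time_bounds[OF assms(1,2) _ assms(3)] in simp)
  show "(\<lambda>m. s / real m) \<longlonglongrightarrow> 0" by (rule lim_const_over_n)
qed

lemma grid_time_le: "0 \<le> s \<Longrightarrow> grid_time s m j \<omega> \<le> s"
proof -
  assume s: "0 \<le> s"
  have "card {i::nat. i < m \<and> N (real i * s / m) \<omega> < j} \<le> card {..<m}" by (intro card_mono) auto
  then have "s / m * card {i::nat. i < m \<and> N (real i * s / m) \<omega> < j} \<le> s / m * m"
    using s by (intro mult_left_mono) auto
  also have "\<dots> \<le> s" using s by simp
  finally show ?thesis by (simp add: grid_time_def)
qed

lemma grid_time_0: "grid_time s m 0 \<omega> = 0"
  by (simp add: grid_time_def)

text \<open>Rounding can merge distinct event times, so only weak monotonicity survives; hence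
  \<open>past_functional\<close> asks for \<open>mono\<close> rather than
  \<open>strict_mono\<close>.\<close>

lemma grid_time_mono: "0 \<le> s \<Longrightarrow> mono (\<lambda>j. grid_time s m j \<omega>)"
  unfolding grid_time_def by (intro monoI mult_left_mono of_nat_mono card_mono) auto


lemma past_functional_bound:
  assumes "past_functional s B F" "0 \<le> s" "\<omega> \<in> space M"
  shows "\<bar>F (N s \<omega>) (\<lambda>j. S j \<omega>)\<bar> \<le> B"
proof -
  have "mono (\<lambda>j. S j \<omega>)" by (rule strict_mono_mono[OF event_times_strict_mono[OF assms(3)]])
  moreover have "S 0 \<omega> = 0" "S (N s \<omega>) \<omega> \<le> s"
    using event_time_0 le_N_iff[of s \<omega> "N s \<omega>"] assms by auto
  ultimately show ?thesis using assms(1) unfolding past_functional_def by blast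
qed

text \<open>Grid times never exceed \<open>s\<close>, whatever the index, so the bound is available
  for every \<open>n\<close> and \<open>\<omega>\<close>.\<close>

lemma past_functional_grid_bound:
  assumes "past_functional s B F" "0 \<le> s"
  shows "\<bar>F n (\<lambda>j. grid_time s m j \<omega>)\<bar> \<le> B"
  using assms(1) grid_time_mono[OF assms(2), of m \<omega>] grid_time_0[of s m \<omega>]
    grid_time_le[OF assms(2), of m n \<omega>]
  unfolding past_functional_def by blast

lemma past_functional_grid_tendsto:
  assumes "past_functional s B F" "0 \<le> s" "\<omega> \<in> space M"
  shows "(\<lambda>m. F (N s \<omega>) (\<lambda>j. grid_time s m j \<omega>)) \<longlonglongrightarrow> F (N s \<omega>) (\<lambda>j. S j \<omega>)"
proof -
  have "(\<lambda>m. grid_time s m j \<omega>) \<longlonglongrightarrow> S j \<omega>" if "j \<le> N s \<omega>" for j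
    using that le_N_iff[OF assms(2,3)] grid_time_tendsto[OF assms(2,3)] by blast
  then show ?thesis
    by (rule assms(1)[unfolded past_functional_def, THEN conjunct2, rule_format])
qed

lemma increment_measurable:
  assumes "0 \<le> s" "0 \<le> t"
  shows "(\<lambda>\<omega>. N t \<omega> - N s \<omega>) \<in> measurable M (count_space UNIV)"
  using random_variable_N[OF assms(1)] random_variable_N[OF assms(2)] by measurable

lemma prob_increment:
  assumes "0 \<le> s" "s < t"
  shows "expectation (\<lambda>\<omega>. indicator A (N t \<omega> - N s \<omega>)) = measure (poisson_pmf (rate * (t - s))) A"
proof -
  have "expectation (\<lambda>\<omega>. indicator A (N t \<omega> - N s \<omega>) :: real) =
      (\<integral>k. indicator A k \<partial>distr M (count_space UNIV) (\<lambda>\<omega>. N t \<omega> - N s \<omega>))"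
    using increment_measurable[of s t] assms by (subst integral_distr) auto
  then show ?thesis by (simp add: poisson_increments[OF assms])
qed

text \<open>\<open>N s\<close> and all grid times are functions of the increments of
  \<open>N\<close> over the cells of the grid on \<open>[0, s]\<close>. Together with the increment
  over \<open>(s, t]\<close> these form one finite family of independent increments.\<close>

lemma grid_functional_indep:
  assumes "past_functional s B F" "0 \<le> s" "s < t" "0 < m"
  defines "Y \<equiv> \<lambda>\<omega>. F (N s \<omega>) (\<lambda>j. grid_time s m j \<omega>)"
  shows "Y \<in> borel_measurable M"
    "expectation (\<lambda>\<omega>. Y \<omega> * indicator A (N t \<omega> - N s \<omega>)) =
      expectation Y * measure (poisson_pmf (rate * (t - s))) A"
proof -
  \<comment> \<open>\<open>m\<close> equal cells of \<open>[0, s]\<close>, followed by one last cell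
    from \<open>s\<close> to \<open>t\<close>.\<close>
  define ts where "ts i = (if i \<le> m then i * s / m else t)" for i
  define V where "V i \<omega> = N (ts (Suc i)) \<omega> - N (ts i) \<omega>" for i \<omega>
  \<comment> \<open>Partial sums of increments recover \<open>N\<close> at the grid points, because
    \<open>N 0 = 0\<close>.\<close>
  define g where "g v = F (\<Sum>i<m. v i) (\<lambda>j. s / m * card {i::nat. i < m \<and> (\<Sum>l<i. v l) < j})"
    for v :: "nat \<Rightarrow> nat"
  have ts: "ts 0 = 0" "ts m = s" "ts (Suc m) = t" using assms by (auto simp: ts_def)
  have ts_step: "ts i \<le> ts (Suc i)" if "i \<le> m" for i
    using assms that by (cases "i = m") (auto simp: ts_def field_simps)
  have ts_nonneg: "0 \<le> ts i" for i using assms by (auto simp: ts_def)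
  have N_sum: "(\<Sum>l<i. V l \<omega>) = N (ts i) \<omega>" if "i \<le> m" "\<omega> \<in> space M" for i \<omega>
    using that
  proof (induction i)
    case (Suc i)
    then show ?case using N_mono[OF ts_nonneg ts_step] by (simp add: V_def)
  qed (simp add: ts N_0)
  have Y: "Y \<omega> = g (restrict (\<lambda>i. V i \<omega>) {..<m})" if "\<omega> \<in> space M" for \<omega>
  proof -
    have "(\<Sum>l<i. restrict (\<lambda>i. V i \<omega>) {..<m} l) = N (real i * s / m) \<omega>" if "i \<le> m" for i
    proof -
      have "(\<Sum>l<i. restrict (\<lambda>i. V i \<omega>) {..<m} l) = (\<Sum>l<i. V l \<omega>)"
        using that by (intro sum.cong) auto
      then show ?thesis using N_sum[OF that \<open>\<omega> \<in> space M\<close>] that by (simp add: ts_def)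
    qed
    then show ?thesis unfolding Y_def g_def grid_time_def
      using assms by (simp cong: conj_cong)
  qed
  have ind: "indep_vars (\<lambda>_. count_space UNIV) V {..<Suc m}"
    unfolding V_def using ts_step ts by (intro independent_increments) auto
  have "indep_var (PiM {..<m} (\<lambda>_. count_space UNIV)) (\<lambda>\<omega>. restrict (\<lambda>i. V i \<omega>) {..<m})
      (PiM {m} (\<lambda>_. count_space UNIV)) (\<lambda>\<omega>. restrict (\<lambda>i. V i \<omega>) {m})"
    by (rule indep_var_restrict[OF ind]) auto
  \<comment> \<open>A finite product of countable discrete spaces is discrete, so every function on
    it, in particular \<open>g\<close>, is measurable.\<close>
  then have "indep_var borel (g \<circ> (\<lambda>\<omega>. restrict (\<lambda>i. V i \<omega>) {..<m}))
      borel ((\<lambda>w. indicator A (w m)) \<circ> (\<lambda>\<omega>. restrict (\<lambda>i. V i \<omega>) {m}))"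
    by (rule indep_var_compose) (simp_all add: count_space_PiM_finite)
  then have ind2: "indep_var borel (\<lambda>\<omega>. g (restrict (\<lambda>i. V i \<omega>) {..<m}))
      borel (\<lambda>\<omega>. indicator A (N t \<omega> - N s \<omega>) :: real)"
    by (simp add: comp_def V_def ts)
  show Y_meas: "Y \<in> borel_measurable M"
    using indep_var_rv1[OF ind2] by (subst measurable_cong[OF Y])
  have "\<bar>Y \<omega>\<bar> \<le> B" for \<omega>
    unfolding Y_def by (rule past_functional_grid_bound[OF assms(1,2)])
  then have "integrable M Y"
    using Y_meas by (auto intro!: integrable_const_bound[where B=B])
  then have "integrable M (\<lambda>\<omega>. g (restrict (\<lambda>i. V i \<omega>) {..<m}))"
    by (subst (asm) Bochner_Integration.integrable_cong[OF refl Y])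
  moreover have "integrable M (\<lambda>\<omega>. indicator A (N t \<omega> - N s \<omega>) :: real)"
    using indep_var_rv2[OF ind2]
    by (auto intro!: integrable_const_bound[where B=1] simp: indicator_def)
  ultimately have "expectation (\<lambda>\<omega>. g (restrict (\<lambda>i. V i \<omega>) {..<m}) * indicator A (N t \<omega> - N s \<omega>)) =
      expectation (\<lambda>\<omega>. g (restrict (\<lambda>i. V i \<omega>) {..<m})) *
      expectation (\<lambda>\<omega>. indicator A (N t \<omega> - N s \<omega>))"
    by (rule indep_var_lebesgue_integral[OF ind2])
  then show "expectation (\<lambda>\<omega>. Y \<omega> * indicator A (N t \<omega> - N s \<omega>)) =
      expectation Y * measure (poisson_pmf (rate * (t - s))) A"
    unfolding prob_increment[OF assms(2,3)]
    by (simp add: Y cong: Bochner_Integration.integral_cong)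
qed

text \<open>As the mesh tends to 0, the product formula passes to the limit by dominated
  convergence, with the constant \<open>B\<close> as majorant. Measurability is inherited from the
  same pointwise limit.\<close>

lemma past_functional_indep:
  assumes "past_functional s B F" "0 \<le> s" "s < t"
  defines "Y \<equiv> \<lambda>\<omega>. F (N s \<omega>) (\<lambda>j. S j \<omega>)"
  shows "Y \<in> borel_measurable M"
    "expectation (\<lambda>\<omega>. Y \<omega> * indicator A (N t \<omega> - N s \<omega>)) =
      expectation Y * measure (poisson_pmf (rate * (t - s))) A"
proof -
  \<comment> \<open>\<open>Suc m\<close> avoids the empty grid, for which no product formula is
    available.\<close>
  define Z where "Z m \<omega> = F (N s \<omega>) (\<lambda>j. grid_time s (Suc m) j \<omega>)" for m \<omega>
  let ?I = "\<lambda>\<omega>. indicator A (N t \<omega> - N s \<omega>) :: real"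
  have Z: "Z m \<in> borel_measurable M" "expectation (\<lambda>\<omega>. Z m \<omega> * ?I \<omega>) =
      expectation (Z m) * measure (poisson_pmf (rate * (t - s))) A" for m
    using grid_functional_indep(1)[OF assms(1-3), of "Suc m"]
      grid_functional_indep(2)[OF assms(1-3), of "Suc m" A]
    by (simp_all add: Z_def[abs_def])
  have I: "?I \<in> borel_measurable M"
    using assms(2,3) by (intro measurable_compose[OF increment_measurable]) auto
  have lim: "(\<lambda>m. Z m \<omega>) \<longlonglongrightarrow> Y \<omega>" if "\<omega> \<in> space M" for \<omega>
    using LIMSEQ_Suc[OF past_functional_grid_tendsto[OF assms(1,2) that]] by (simp add: Z_def Y_def)
  show Y: "Y \<in> borel_measurable M"
    by (rule borel_measurable_LIMSEQ_real[OF lim Z(1)])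
  have bound: "\<bar>Z m \<omega>\<bar> \<le> B" for m \<omega>
    unfolding Z_def by (rule past_functional_grid_bound[OF assms(1,2)])
  have B: "0 \<le> B" using bound[of 0 undefined] by simp
  have "(\<lambda>m. expectation (\<lambda>\<omega>. Z m \<omega> * ?I \<omega>)) \<longlonglongrightarrow> expectation (\<lambda>\<omega>. Y \<omega> * ?I \<omega>)"
    using Y Z(1) I bound B
    by (intro integral_dominated_convergence[where w="\<lambda>_. B"])
       (auto intro!: tendsto_intros lim simp: indicator_def)
  moreover have "(\<lambda>m. expectation (Z m)) \<longlonglongrightarrow> expectation Y"
    using Y Z(1) bound B
    by (intro integral_dominated_convergence[where w="\<lambda>_. B"]) (auto intro!: lim)
  ultimately show "expectation (\<lambda>\<omega>. Y \<omega> * ?I \<omega>) =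
      expectation Y * measure (poisson_pmf (rate * (t - s))) A"
    unfolding Z(2) by (rule LIMSEQ_unique[OF _ tendsto_mult_right])
qed

lemma past_functional_measurable:
  assumes "past_functional s B F" "0 \<le> s"
  shows "(\<lambda>\<omega>. F (N s \<omega>) (\<lambda>j. S j \<omega>)) \<in> borel_measurable M"
    "integrable M (\<lambda>\<omega>. F (N s \<omega>) (\<lambda>j. S j \<omega>))"
    "\<bar>expectation (\<lambda>\<omega>. F (N s \<omega>) (\<lambda>j. S j \<omega>))\<bar> \<le> B"
proof -
  show m: "(\<lambda>\<omega>. F (N s \<omega>) (\<lambda>j. S j \<omega>)) \<in> borel_measurable M"
    \<comment> \<open>Any time later than \<open>s\<close> would do.\<close>
    using past_functional_indep(1)[OF assms, of "s + 1"] by simp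
  show i: "integrable M (\<lambda>\<omega>. F (N s \<omega>) (\<lambda>j. S j \<omega>))"
    using m past_functional_bound[OF assms] by (auto intro!: integrable_const_bound[where B=B])
  have "\<bar>expectation (\<lambda>\<omega>. F (N s \<omega>) (\<lambda>j. S j \<omega>))\<bar> \<le> expectation (\<lambda>\<omega>. \<bar>F (N s \<omega>) (\<lambda>j. S j \<omega>)\<bar>)"
    by (rule integral_abs_bound)
  also have "\<dots> \<le> expectation (\<lambda>\<omega>. B)"
    using i past_functional_bound[OF assms] by (intro integral_mono) auto
  finally show "\<bar>expectation (\<lambda>\<omega>. F (N s \<omega>) (\<lambda>j. S j \<omega>))\<bar> \<le> B" by (simp add: prob_space)
qed

end

section \<open>Differential equations for the means\<close>

text \<open>The estimate uses \<open>b\<close> at the left end of the interval, so a difference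
  quotient taken to the left of \<open>t\<close> involves \<open>b\<close> at the moving point and
  converges only if \<open>b\<close> is continuous. For a system whose right-hand sides
  \<open>b\<close> are combinations of the unknowns, the first claim, which needs only bounded
  \<open>b\<close>, supplies this continuity for all components at once.\<close>

lemma has_derivative_of_quadratic_increment:
  fixes a b :: "real \<Rightarrow> real"
  assumes "0 < \<delta>"
    and incr: "\<And>T. \<exists>K. \<forall>s t. 0 \<le> s \<longrightarrow> s < t \<longrightarrow> t \<le> T \<longrightarrow> t - s \<le> \<delta> \<longrightarrow>
      \<bar>a t - a s - (t - s) * b s\<bar> \<le> K * (t - s)\<^sup>2"
    and bdd: "\<And>T. \<exists>B. \<forall>s. 0 \<le> s \<longrightarrow> s \<le> T \<longrightarrow> \<bar>b s\<bar> \<le> B"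
  shows "continuous_on {0..} a"
    and "continuous_on {0..} b \<Longrightarrow> 0 \<le> t \<Longrightarrow> (a has_real_derivative b t) (at t within {0..})"
proof -
  \<comment> \<open>\<open>min y t\<close> is the left end of the interval between \<open>y\<close>
    and \<open>t\<close>, which treats both sides of \<open>t\<close> together.\<close>
  have near: "\<exists>K. \<forall>\<^sub>F y in at t within {0..}. y \<noteq> t \<and> 0 \<le> min y t \<and> \<bar>b (min y t)\<bar> \<le> B \<and>
      \<bar>a y - a t - (y - t) * b (min y t)\<bar> \<le> K * (y - t)\<^sup>2"
    if t: "0 \<le> t" and B: "\<And>s. 0 \<le> s \<Longrightarrow> s \<le> t \<Longrightarrow> \<bar>b s\<bar> \<le> B" for t B
  proof -
    obtain K where K: "\<And>s r. 0 \<le> s \<Longrightarrow> s < r \<Longrightarrow> r \<le> t + 1 \<Longrightarrow> r - s \<le> \<delta> \<Longrightarrow>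
        \<bar>a r - a s - (r - s) * b s\<bar> \<le> K * (r - s)\<^sup>2"
      using incr[of "t + 1"] by blast
    have "\<forall>\<^sub>F y in at t within {0..}. y \<noteq> t \<and> y \<in> {0..} \<and> dist y t < min \<delta> 1"
      unfolding eventually_at using assms(1) by (intro exI[of _ "min \<delta> 1"]) auto
    then have "\<forall>\<^sub>F y in at t within {0..}. y \<noteq> t \<and> 0 \<le> min y t \<and> \<bar>b (min y t)\<bar> \<le> B \<and>
      \<bar>a y - a t - (y - t) * b (min y t)\<bar> \<le> K * (y - t)\<^sup>2"
    proof eventually_elim
      case (elim y)
      then have y: "y \<noteq> t" "0 \<le> y" "\<bar>y - t\<bar> < \<delta>" "\<bar>y - t\<bar> < 1" by (auto simp: dist_real_def)
      show ?case
      proof (cases "t < y")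
        case True
        then show ?thesis using y t K[of t y] B[of t] by (auto simp: min_def)
      next
        case False
        then have "y < t" using y by auto
        moreover have "\<bar>a y - a t - (y - t) * b y\<bar> = \<bar>a t - a y - (t - y) * b y\<bar>"
          by (simp add: algebra_simps)
        ultimately show ?thesis using y K[of y t] B[of y] power2_commute[of t y]
          by (auto simp: min_def)
      qed
    qed
    then show ?thesis by blast
  qed
  show "continuous_on {0..} a"
    unfolding continuous_on_def
  proof
    fix t :: real assume "t \<in> {0..}"
    then have t: "0 \<le> t" by simp
    obtain B where B: "\<And>s. 0 \<le> s \<Longrightarrow> s \<le> t \<Longrightarrow> \<bar>b s\<bar> \<le> B" using bdd by blast
    obtain K where K: "\<forall>\<^sub>F y in at t within {0..}. y \<noteq> t \<and> 0 \<le> min y t \<and> \<bar>b (min y t)\<bar> \<le> B \<and>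
      \<bar>a y - a t - (y - t) * b (min y t)\<bar> \<le> K * (y - t)\<^sup>2"
      using near[OF t B] by blast
    show "(a \<longlongrightarrow> a t) (at t within {0..})"
    proof (rule Lim_null[THEN iffD2], rule Lim_null_comparison)
      show "\<forall>\<^sub>F y in at t within {0..}. norm (a y - a t) \<le> \<bar>y - t\<bar> * B + K * (y - t)\<^sup>2"
        using K
      proof eventually_elim
        case (elim y)
        then have "\<bar>y - t\<bar> * \<bar>b (min y t)\<bar> \<le> \<bar>y - t\<bar> * B" by (intro mult_left_mono) auto
        then have "\<bar>(y - t) * b (min y t)\<bar> \<le> \<bar>y - t\<bar> * B" by (simp add: abs_mult)
        then show ?case using elim unfolding real_norm_def by linarith
      qed
      have "((\<lambda>y. \<bar>y - t\<bar> * B + K * (y - t)\<^sup>2) \<longlongrightarrow> \<bar>t - t\<bar> * B + K * (t - t)\<^sup>2) (at t within {0..})"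
        by (intro tendsto_intros)
      then show "((\<lambda>y. \<bar>y - t\<bar> * B + K * (y - t)\<^sup>2) \<longlongrightarrow> 0) (at t within {0..})" by simp
    qed
  qed
  assume cont: "continuous_on {0..} b" and t: "0 \<le> t"
  obtain B where B: "\<And>s. 0 \<le> s \<Longrightarrow> s \<le> t \<Longrightarrow> \<bar>b s\<bar> \<le> B" using bdd by blast
  obtain K where K: "\<forall>\<^sub>F y in at t within {0..}. y \<noteq> t \<and> 0 \<le> min y t \<and> \<bar>b (min y t)\<bar> \<le> B \<and>
    \<bar>a y - a t - (y - t) * b (min y t)\<bar> \<le> K * (y - t)\<^sup>2"
    using near[OF t B] by blast
  have b_lim: "((\<lambda>y. b (min y t)) \<longlongrightarrow> b t) (at t within {0..})"
  proof -
    have "continuous_on {0..} (\<lambda>y. b (min y t))"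
      using t by (intro continuous_on_compose2[OF cont] continuous_intros) auto
    then show ?thesis using t unfolding continuous_on_def by force
  qed
  have "((\<lambda>y. (a y - a t) / (y - t) - b (min y t)) \<longlongrightarrow> 0) (at t within {0..})"
  proof (rule Lim_null_comparison)
    show "\<forall>\<^sub>F y in at t within {0..}. norm ((a y - a t) / (y - t) - b (min y t)) \<le> K * \<bar>y - t\<bar>"
      using K
    proof eventually_elim
      case (elim y)
      then have "(a y - a t) / (y - t) - b (min y t) = (a y - a t - (y - t) * b (min y t)) / (y - t)"
        by (simp add: diff_divide_distrib)
      also have "norm \<dots> \<le> K * (y - t)\<^sup>2 / \<bar>y - t\<bar>"
        using elim by (simp add: abs_divide divide_right_mono)
      also have "(y - t)\<^sup>2 = \<bar>y - t\<bar> * \<bar>y - t\<bar>" by (simp add: power2_eq_square)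
      finally show ?case using elim by (simp del: abs_mult_self_eq)
    qed
    have "((\<lambda>y. K * \<bar>y - t\<bar>) \<longlongrightarrow> K * \<bar>t - t\<bar>) (at t within {0..})" by (intro tendsto_intros)
    then show "((\<lambda>y. K * \<bar>y - t\<bar>) \<longlongrightarrow> 0) (at t within {0..})" by simp
  qed
  from tendsto_add[OF this b_lim] show "(a has_real_derivative b t) (at t within {0..})"
    unfolding has_field_derivative_iff by simp
qed

lemma past_functional_mono: "past_functional s B F \<Longrightarrow> B \<le> B' \<Longrightarrow> past_functional s B' F"
  unfolding past_functional_def by (meson order_trans)

lemma past_functional_scale:
  assumes "past_functional s B F"
  shows "past_functional s (\<bar>k\<bar> * B) (\<lambda>n x. k * F n x)"
  using assms unfolding past_functional_def
  by (auto simp: abs_mult intro!: mult_left_mono tendsto_mult_left)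

lemma leg_prod_tendsto:
  assumes "\<And>j. j \<le> n \<Longrightarrow> (\<lambda>m. X m j) \<longlonglongrightarrow> x j"
  shows "(\<lambda>m. leg_prod c (X m) n) \<longlonglongrightarrow> leg_prod c x n"
  unfolding leg_prod_def by (intro tendsto_prod tendsto_cosh tendsto_intros assms) auto

lemma last_term_tendsto:
  assumes "\<And>j. j \<le> n \<Longrightarrow> (\<lambda>m. X m j) \<longlonglongrightarrow> x j" "continuous_on UNIV f"
  shows "(\<lambda>m. last_term f c n (X m) t) \<longlonglongrightarrow> last_term f c n x t"
  unfolding last_term_def
  by (intro tendsto_divide tendsto_mult leg_prod_tendsto continuous_on_tendsto_compose[OF assms(2)]
      tendsto_intros assms(1)) auto

lemma cm_term_tendsto:
  assumes "\<And>j. j \<le> n \<Longrightarrow> (\<lambda>m. X m j) \<longlonglongrightarrow> x j" "continuous_on UNIV f"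
  shows "(\<lambda>m. cm_term f c n (X m) t) \<longlonglongrightarrow> cm_term f c n x t"
  unfolding cm_term_def
  by (intro tendsto_add tendsto_sum last_term_tendsto assms tendsto_divide tendsto_mult leg_prod_tendsto
      continuous_on_tendsto_compose[OF assms(2)] tendsto_intros assms(1)) auto

text \<open>The bound is taken at a horizon \<open>T\<close> so that one constant serves all times
  \<open>s \<le> T\<close>.\<close>

lemma past_functional_terms:
  assumes "0 \<le> c" "s \<le> T"
  shows "past_functional s (exp (c * T)) (\<lambda>n x. last_term cosh c n x s)"
    "past_functional s (exp (c * T)) (\<lambda>n x. last_term sinh c n x s)"
    "past_functional s (exp (c * T)) (\<lambda>n x. cm_term cosh c n x s)"
    "past_functional s (exp (c * T)) (\<lambda>n x. cm_term sinh c n x s)"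
proof -
  have cont: "continuous_on UNIV (cosh :: real \<Rightarrow> real)" "continuous_on UNIV (sinh :: real \<Rightarrow> real)"
    by (intro continuous_intros)+
  have "\<bar>last_term cosh c n x s\<bar> \<le> exp (c * T)" "\<bar>last_term sinh c n x s\<bar> \<le> exp (c * T)"
    "\<bar>cm_term cosh c n x s\<bar> \<le> exp (c * T)" "\<bar>cm_term sinh c n x s\<bar> \<le> exp (c * T)"
    if "mono x" "x 0 = 0" "x n \<le> s" for n x
  proof -
    have "exp (c * s) \<le> exp (c * T)" using assms by (simp add: mult_left_mono)
    then show "\<bar>last_term cosh c n x s\<bar> \<le> exp (c * T)" "\<bar>last_term sinh c n x s\<bar> \<le> exp (c * T)"
      "\<bar>cm_term cosh c n x s\<bar> \<le> exp (c * T)" "\<bar>cm_term sinh c n x s\<bar> \<le> exp (c * T)"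
      using cm_term_cosh_le_exp[OF assms(1) that] last_term_cosh_nonneg[of c n x s]
        last_term_cosh_le_cm_term[of c n x s] abs_last_term_sinh_le[of c n x s]
        abs_cm_term_sinh_le[of c n x s] by linarith+
  qed
  then show "past_functional s (exp (c * T)) (\<lambda>n x. last_term cosh c n x s)"
    "past_functional s (exp (c * T)) (\<lambda>n x. last_term sinh c n x s)"
    "past_functional s (exp (c * T)) (\<lambda>n x. cm_term cosh c n x s)"
    "past_functional s (exp (c * T)) (\<lambda>n x. cm_term sinh c n x s)"
    unfolding past_functional_def
    by (auto intro!: last_term_tendsto cm_term_tendsto cont)
qed

context poisson_process
begin

text \<open>
  \<open>F1\<close> is the drift without events and \<open>F2\<close> the jump caused by a single event; two or more events
  in \<open>(s, t]\<close> have probability of order \<open>(t - s)\<^sup>2\<close>.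
\<close>

lemma expectation_increment:
  assumes "0 \<le> s" "s < t" "0 \<le> K"
    and past: "past_functional s B F" "past_functional s B F1" "past_functional s B F2"
      "past_functional t B G"
    and no_event: "\<And>\<omega>. \<omega> \<in> space M \<Longrightarrow> N t \<omega> = N s \<omega> \<Longrightarrow>
      \<bar>G (N t \<omega>) (\<lambda>j. S j \<omega>) - F (N s \<omega>) (\<lambda>j. S j \<omega>) - (t - s) * F1 (N s \<omega>) (\<lambda>j. S j \<omega>)\<bar>
        \<le> K * (t - s)\<^sup>2"
    and one_event: "\<And>\<omega>. \<omega> \<in> space M \<Longrightarrow> N t \<omega> = Suc (N s \<omega>) \<Longrightarrow>
      \<bar>G (N t \<omega>) (\<lambda>j. S j \<omega>) - F (N s \<omega>) (\<lambda>j. S j \<omega>) - F2 (N s \<omega>) (\<lambda>j. S j \<omega>)\<bar> \<le> K * (t - s)"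
  shows "\<bar>expectation (\<lambda>\<omega>. G (N t \<omega>) (\<lambda>j. S j \<omega>)) - expectation (\<lambda>\<omega>. F (N s \<omega>) (\<lambda>j. S j \<omega>))
      - (t - s) * (expectation (\<lambda>\<omega>. F1 (N s \<omega>) (\<lambda>j. S j \<omega>))
          + rate * expectation (\<lambda>\<omega>. F2 (N s \<omega>) (\<lambda>j. S j \<omega>)))\<bar>
    \<le> (K + rate * K + 3 * B * rate\<^sup>2 + B * rate) * (t - s)\<^sup>2"
proof -
  define h where "h = t - s"
  define f where "f \<omega> = F (N s \<omega>) (\<lambda>j. S j \<omega>)" for \<omega>
  define f1 where "f1 \<omega> = F1 (N s \<omega>) (\<lambda>j. S j \<omega>)" for \<omega>
  define f2 where "f2 \<omega> = F2 (N s \<omega>) (\<lambda>j. S j \<omega>)" for \<omega>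
  define g where "g \<omega> = G (N t \<omega>) (\<lambda>j. S j \<omega>)" for \<omega>
  define I where "I A \<omega> = (indicator A (N t \<omega> - N s \<omega>) :: real)" for A \<omega>
  define p where "p A = measure (poisson_pmf (rate * h)) A" for A
  have h: "0 < h" "0 < rate * h" and t: "0 \<le> t" using assms rate_pos by (auto simp: h_def)
  have bound: "\<bar>f \<omega>\<bar> \<le> B" "\<bar>g \<omega>\<bar> \<le> B" if "\<omega> \<in> space M" for \<omega>
    unfolding f_def g_def using past_functional_bound[OF past(1) assms(1) that]
      past_functional_bound[OF past(4) t that] by auto
  have B: "0 \<le> B" using bound(1) not_empty by fastforce
  have int: "integrable M f" "integrable M f1" "integrable M f2" "integrable M g"
    unfolding f_def f1_def f2_def g_def
    using past_functional_measurable(2) past assms(1) t by blast+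
  have I_meas [measurable]: "I A \<in> borel_measurable M" for A
    unfolding I_def using assms(1) t by (intro measurable_compose[OF increment_measurable]) auto
  have I_bound: "\<bar>I A \<omega>\<bar> \<le> 1" for A \<omega> by (simp add: I_def indicator_def)
  have int_I: "integrable M (I A)" for A
    using I_bound by (auto intro!: integrable_const_bound[where B=1])
  have int_mult: "integrable M (\<lambda>\<omega>. u \<omega> * I A \<omega>)" if "integrable M u" for u A
  proof (rule Bochner_Integration.integrable_bound[OF that])
    show "AE \<omega> in M. norm (u \<omega> * I A \<omega>) \<le> norm (u \<omega>)"
      using I_bound by (auto simp: abs_mult intro!: mult_left_le)
  qed (use that in measurable)
  have EI: "expectation (I A) = p A" for A
    unfolding I_def p_def h_def by (rule prob_increment[OF assms(1,2)])
  have E1: "expectation (\<lambda>\<omega>. f1 \<omega> * I A \<omega>) = expectation f1 * p A"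
    and E2: "expectation (\<lambda>\<omega>. f2 \<omega> * I A \<omega>) = expectation f2 * p A" for A
    unfolding f1_def f2_def I_def p_def h_def
    using past_functional_indep(2) past(2,3) assms(1,2) by blast+
  have Ef: "\<bar>expectation f1\<bar> \<le> B" "\<bar>expectation f2\<bar> \<le> B"
    unfolding f1_def f2_def using past_functional_measurable(3) past assms(1) by blast+
  \<comment> \<open>What remains of the increment after removing the drift on the event of no jump
    and the jump on the event of exactly one; with two or more jumps only the bound
    \<open>2 * B\<close> is used.\<close>
  define q where "q \<omega> = g \<omega> - f \<omega> - h * (f1 \<omega> * I {0} \<omega>) - f2 \<omega> * I {1} \<omega>" for \<omega>
  have int_q: "integrable M q"
    unfolding q_def by (intro Bochner_Integration.integrable_diff Bochner_Integration.integrable_mult_right int int_mult)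
  have Eq: "expectation q = expectation g - expectation f - h * (expectation f1 * p {0}) - expectation f2 * p {1}"
    unfolding q_def
    by (simp add: int int_mult E1 E2)
  have q_le: "\<bar>q \<omega>\<bar> \<le> K * h\<^sup>2 + K * h * I {1} \<omega> + 2 * B * I {2..} \<omega>" if \<omega>: "\<omega> \<in> space M" for \<omega>
  proof -
    have le: "N s \<omega> \<le> N t \<omega>" using N_mono[OF assms(1) _ \<omega>] assms(2) by simp
    have Kh: "0 \<le> K * h\<^sup>2" "0 \<le> K * h" using assms(3) h by auto
    consider "N t \<omega> = N s \<omega>" | "N t \<omega> = Suc (N s \<omega>)" | "2 \<le> N t \<omega> - N s \<omega>"
      using le by linarith
    then show ?thesis
    proof cases
      case 1
      then show ?thesis using no_event[OF \<omega> 1]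
        by (simp add: q_def I_def f_def f1_def g_def h_def)
    next
      case 2
      then show ?thesis using one_event[OF \<omega> 2] Kh
        by (simp add: q_def I_def f_def f2_def g_def h_def)
    next
      case 3
      then show ?thesis using bound[OF \<omega>] Kh by (simp add: q_def I_def)
    qed
  qed
  have "\<bar>expectation q\<bar> \<le> expectation (\<lambda>\<omega>. \<bar>q \<omega>\<bar>)" by (rule integral_abs_bound)
  also have "\<dots> \<le> expectation (\<lambda>\<omega>. K * h\<^sup>2 + K * h * I {1} \<omega> + 2 * B * I {2..} \<omega>)"
    using int_q int_I q_le by (intro integral_mono) auto
  also have "\<dots> = K * h\<^sup>2 + K * h * p {1} + 2 * B * p {2..}"
    using int_I by (simp add: EI prob_space)
  finally have q: "\<bar>expectation q\<bar> \<le> K * h\<^sup>2 + K * h * p {1} + 2 * B * p {2..}" .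
  have p: "p {0} = exp (- (rate * h))" "p {1} = rate * h * exp (- (rate * h))" "p {2..} \<le> (rate * h)\<^sup>2"
    using pmf_poisson_0_1[OF h(2)] poisson_measure_ge2[OF h(2)] by (simp_all add: p_def measure_pmf_single)
  have e: "0 \<le> 1 - exp (- (rate * h))" "1 - exp (- (rate * h)) \<le> rate * h"
    using exp_ge_add_one_self[of "- (rate * h)"] h by auto
  have "K * h * p {1} \<le> K * h * (rate * h)"
    unfolding p using e h assms(3) by (intro mult_left_mono) (auto intro!: mult_left_le)
  moreover have "2 * B * p {2..} \<le> 2 * B * (rate * h)\<^sup>2"
    using p(3) B by (intro mult_left_mono) auto
  \<comment> \<open>Replacing \<open>p {0}\<close> by 1, and below \<open>p {1}\<close> by
    \<open>rate * h\<close>, costs another error of order \<open>h\<^sup>2\<close>.\<close>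
  moreover have "\<bar>h * (expectation f1 * (p {0} - 1))\<bar> \<le> h * (B * (rate * h))"
  proof -
    have "\<bar>expectation f1\<bar> * \<bar>p {0} - 1\<bar> \<le> B * (rate * h)"
      unfolding p using e Ef B by (intro mult_mono) auto
    then show ?thesis using h by (simp add: abs_mult)
  qed
  moreover have "\<bar>expectation f2 * (p {1} - rate * h)\<bar> \<le> B * ((rate * h) * (rate * h))"
  proof -
    have "p {1} - rate * h = - (rate * h) * (1 - exp (- (rate * h)))"
      unfolding p by (simp add: algebra_simps)
    then have "\<bar>p {1} - rate * h\<bar> = (rate * h) * (1 - exp (- (rate * h)))"
      using h rate_pos e by (simp add: abs_mult)
    also have "\<dots> \<le> (rate * h) * (rate * h)" using e h(2) by (intro mult_left_mono) auto
    finally have "\<bar>expectation f2\<bar> * \<bar>p {1} - rate * h\<bar> \<le> B * ((rate * h) * (rate * h))"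
      using Ef B by (intro mult_mono) auto
    then show ?thesis by (simp add: abs_mult)
  qed
  moreover have "expectation g - expectation f - h * (expectation f1 + rate * expectation f2) =
      expectation q + h * (expectation f1 * (p {0} - 1)) + expectation f2 * (p {1} - rate * h)"
    unfolding Eq by (simp add: algebra_simps)
  \<comment> \<open>Of the three \<open>B * rate\<^sup>2\<close>, two come from multiple events and
    one from approximating \<open>p {1}\<close>; \<open>B * rate\<close> comes from
    \<open>p {0}\<close>, and the terms with \<open>K\<close> from the cases of no event and of one
    event.\<close>
  moreover have "(K + rate * K + 3 * B * rate\<^sup>2 + B * rate) * h\<^sup>2 =
      K * h\<^sup>2 + K * h * (rate * h) + 2 * B * (rate * h)\<^sup>2 + h * (B * (rate * h)) + B * ((rate * h) * (rate * h))"
    by (simp add: algebra_simps power2_eq_square)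
  ultimately have "\<bar>expectation g - expectation f - h * (expectation f1 + rate * expectation f2)\<bar>
      \<le> (K + rate * K + 3 * B * rate\<^sup>2 + B * rate) * h\<^sup>2"
    using q by linarith
  then show ?thesis by (simp add: f_def[abs_def] f1_def[abs_def] f2_def[abs_def] g_def[abs_def] h_def)
qed

definition mean_last :: "(real \<Rightarrow> real) \<Rightarrow> real \<Rightarrow> real \<Rightarrow> real" where
  "mean_last f c t = expectation (\<lambda>\<omega>. last_term f c (N t \<omega>) (\<lambda>j. S j \<omega>) t)"

definition mean_cm :: "(real \<Rightarrow> real) \<Rightarrow> real \<Rightarrow> real \<Rightarrow> real" where
  "mean_cm f c t = expectation (\<lambda>\<omega>. cm_term f c (N t \<omega>) (\<lambda>j. S j \<omega>) t)"

lemma mean_bound: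
  assumes "0 \<le> c" "0 \<le> t" "t \<le> T"
  shows "\<bar>mean_last cosh c t\<bar> \<le> exp (c * T)" "\<bar>mean_last sinh c t\<bar> \<le> exp (c * T)"
    "\<bar>mean_cm cosh c t\<bar> \<le> exp (c * T)" "\<bar>mean_cm sinh c t\<bar> \<le> exp (c * T)"
  unfolding mean_last_def mean_cm_def
  using past_functional_measurable(3)[OF past_functional_terms(1)[OF assms(1,3)] assms(2)]
    past_functional_measurable(3)[OF past_functional_terms(2)[OF assms(1,3)] assms(2)]
    past_functional_measurable(3)[OF past_functional_terms(3)[OF assms(1,3)] assms(2)]
    past_functional_measurable(3)[OF past_functional_terms(4)[OF assms(1,3)] assms(2)]
  by auto

text \<open>
  An event splits the last particle in two halves, one of which restarts with a new leg: it halves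
  the last \<^const>\<open>cosh\<close> summand, resets the last \<^const>\<open>sinh\<close> summand to zero, leaves \<open>cosh \<eta>\<^sub>c\<^sub>m\<close>
  continuous and lowers the \<^const>\<open>sinh\<close> version of the sum by half its last summand.
\<close>

lemma mean_increments:
  assumes c: "0 < c"
  shows "\<exists>K. \<forall>s t. 0 \<le> s \<longrightarrow> s < t \<longrightarrow> t \<le> T \<longrightarrow> t - s \<le> 1 / c \<longrightarrow>
    \<bar>mean_last cosh c t - mean_last cosh c s -
      (t - s) * (c * mean_last sinh c s - rate / 2 * mean_last cosh c s)\<bar> \<le> K * (t - s)\<^sup>2" (is ?th1)
  and "\<exists>K. \<forall>s t. 0 \<le> s \<longrightarrow> s < t \<longrightarrow> t \<le> T \<longrightarrow> t - s \<le> 1 / c \<longrightarrow>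
    \<bar>mean_last sinh c t - mean_last sinh c s -
      (t - s) * (c * mean_last cosh c s - rate * mean_last sinh c s)\<bar> \<le> K * (t - s)\<^sup>2" (is ?th2)
  and "\<exists>K. \<forall>s t. 0 \<le> s \<longrightarrow> s < t \<longrightarrow> t \<le> T \<longrightarrow> t - s \<le> 1 / c \<longrightarrow>
    \<bar>mean_cm cosh c t - mean_cm cosh c s - (t - s) * (c * mean_cm sinh c s)\<bar> \<le> K * (t - s)\<^sup>2" (is ?th3)
  and "\<exists>K. \<forall>s t. 0 \<le> s \<longrightarrow> s < t \<longrightarrow> t \<le> T \<longrightarrow> t - s \<le> 1 / c \<longrightarrow>
    \<bar>mean_cm sinh c t - mean_cm sinh c s -
      (t - s) * (c * mean_cm cosh c s - rate / 2 * mean_last sinh c s)\<bar> \<le> K * (t - s)\<^sup>2" (is ?th4)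
proof -
  define B0 where "B0 = exp (c * T)"
  \<comment> \<open>The factor \<open>1 + c\<close> makes \<open>B\<close> a bound for the terms and
    for their drifts, which are scaled by \<open>c\<close>. In \<open>K\<close>, the part with
    \<open>c\<^sup>2\<close> is the error of the motion without events, and the part with
    \<open>c\<close> comes from \<open>exp y - 1 \<le> 2 * y\<close> at an event. The restriction
    \<open>t - s \<le> 1 / c\<close> ensures \<open>y \<le> 1\<close> in both.\<close>
  define B where "B = (1 + c) * B0"
  define K where "K = 2 * B0 * c\<^sup>2 + 2 * B0 * c"
  define K' where "K' = K + rate * K + 3 * B * rate\<^sup>2 + B * rate"
  have B0: "0 \<le> B0" "B0 \<le> B" "c * B0 \<le> B" and K: "0 \<le> K"
    using c by (simp_all add: B0_def B_def K_def algebra_simps)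
  have main:
    "\<bar>mean_last cosh c t - mean_last cosh c s -
      (t - s) * (c * mean_last sinh c s - rate / 2 * mean_last cosh c s)\<bar> \<le> K' * (t - s)\<^sup>2"
    "\<bar>mean_last sinh c t - mean_last sinh c s -
      (t - s) * (c * mean_last cosh c s - rate * mean_last sinh c s)\<bar> \<le> K' * (t - s)\<^sup>2"
    "\<bar>mean_cm cosh c t - mean_cm cosh c s - (t - s) * (c * mean_cm sinh c s)\<bar> \<le> K' * (t - s)\<^sup>2"
    "\<bar>mean_cm sinh c t - mean_cm sinh c s -
      (t - s) * (c * mean_cm cosh c s - rate / 2 * mean_last sinh c s)\<bar> \<le> K' * (t - s)\<^sup>2"
    if s: "0 \<le> s" and st: "s < t" and T: "t \<le> T" and small: "t - s \<le> 1 / c" for s t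
  proof -
    define y where "y = c * (t - s)"
    have y: "0 \<le> y" "y \<le> 1" and sT: "s \<le> T" and t: "0 \<le> t"
      using s st T small c by (auto simp: y_def field_simps)
    note p_s = past_functional_terms[OF less_imp_le[OF c] sT, folded B0_def]
    note p_t = past_functional_terms[OF less_imp_le[OF c] T, folded B0_def]
    have P: "past_functional r B F" if "past_functional r B0 F" for r F
      using past_functional_mono[OF that B0(2)] .
    have Pc: "past_functional r B (\<lambda>n x. c * F n x)" if "past_functional r B0 F" for r F
      using past_functional_mono[OF past_functional_scale[OF that, of c]] B0(3) c by simp
    have Ph: "past_functional r B (\<lambda>n x. (- (1 / 2)) * F n x)" if "past_functional r B0 F" for r F
      using past_functional_mono[OF past_functional_scale[OF that, of "- (1 / 2)"], of B] B0 by simp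
    have Pm: "past_functional r B (\<lambda>n x. (- 1) * F n x)" if "past_functional r B0 F" for r F
      using past_functional_mono[OF past_functional_scale[OF that, of "- 1"], of B] B0 by simp
    have P0: "past_functional r B (\<lambda>n x. 0 :: real)" for r
      using B0 by (simp add: past_functional_def)
    have ey: "(exp y - 1) * u \<le> K * (t - s)" if "u \<le> B0" "0 \<le> u" for u
    proof -
      have "(exp y - 1) * u \<le> (2 * y) * B0"
        using that y cosh_sinh_taylor(3)[OF y] by (intro mult_mono) auto
      also have "\<dots> = 2 * B0 * c * (t - s)" by (simp add: y_def)
      also have "\<dots> \<le> K * (t - s)"
        using st B0 by (intro mult_right_mono) (auto simp: K_def)
      finally show ?thesis .
    qed
    have flow: "\<bar>cosh y * p + sinh y * q - p - (t - s) * (c * q)\<bar> \<le> K * (t - s)\<^sup>2"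
      if "\<bar>p\<bar> \<le> B0" "\<bar>q\<bar> \<le> B0" for p q
    proof -
      have "\<bar>cosh y * p + sinh y * q - p - y * q\<bar> \<le> 2 * B0 * y\<^sup>2"
        by (rule abs_flow_le[OF y that])
      also have "\<dots> = 2 * B0 * c\<^sup>2 * (t - s)\<^sup>2" by (simp add: y_def power_mult_distrib)
      also have "\<dots> \<le> K * (t - s)\<^sup>2"
        using B0 c by (intro mult_right_mono) (auto simp: K_def)
      finally show ?thesis by (simp add: y_def mult.assoc mult.left_commute)
    qed
    have t_eq: "t = s + (t - s)" by simp
    have path:
      "mono (\<lambda>j. S j \<omega>)" "S (N s \<omega>) \<omega> \<le> s" "s \<le> S (Suc (N s \<omega>)) \<omega>"
      "\<And>n. N t \<omega> = Suc n \<Longrightarrow> S (Suc n) \<omega> \<le> t"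
      if "\<omega> \<in> space M" for \<omega>
      using strict_mono_mono[OF event_times_strict_mono[OF that]]
        le_N_iff[OF s that, of "N s \<omega>"] le_N_iff[OF s that, of "Suc (N s \<omega>)"]
        le_N_iff[OF t that, of "N t \<omega>"] by auto
    have bounds:
      "\<bar>last_term cosh c (N s \<omega>) (\<lambda>j. S j \<omega>) s\<bar> \<le> B0" "\<bar>last_term sinh c (N s \<omega>) (\<lambda>j. S j \<omega>) s\<bar> \<le> B0"
      "\<bar>cm_term cosh c (N s \<omega>) (\<lambda>j. S j \<omega>) s\<bar> \<le> B0" "\<bar>cm_term sinh c (N s \<omega>) (\<lambda>j. S j \<omega>) s\<bar> \<le> B0"
      if "\<omega> \<in> space M" for \<omega>
      using past_functional_bound[OF p_s(1) s that] past_functional_bound[OF p_s(2) s that]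
        past_functional_bound[OF p_s(3) s that] past_functional_bound[OF p_s(4) s that] .
    have nonneg: "0 \<le> last_term cosh c n x r" "0 \<le> cm_term cosh c n x r" for n x r
      using last_term_cosh_nonneg[of c n x r] last_term_cosh_le_cm_term[of c n x r] by linarith+
    note jumps = last_term_jump[OF less_imp_le[OF c] path, folded y_def]
      cm_term_jump[OF less_imp_le[OF c] path, folded y_def]
    show "\<bar>mean_last cosh c t - mean_last cosh c s -
      (t - s) * (c * mean_last sinh c s - rate / 2 * mean_last cosh c s)\<bar> \<le> K' * (t - s)\<^sup>2"
    proof -
      have "\<bar>expectation (\<lambda>\<omega>. last_term cosh c (N t \<omega>) (\<lambda>j. S j \<omega>) t) -
          expectation (\<lambda>\<omega>. last_term cosh c (N s \<omega>) (\<lambda>j. S j \<omega>) s) -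
          (t - s) * (expectation (\<lambda>\<omega>. c * last_term sinh c (N s \<omega>) (\<lambda>j. S j \<omega>) s) +
            rate * expectation (\<lambda>\<omega>. - (1 / 2) * last_term cosh c (N s \<omega>) (\<lambda>j. S j \<omega>) s))\<bar>
        \<le> K' * (t - s)\<^sup>2"
        unfolding K'_def
      proof (rule expectation_increment[OF s st K P[OF p_s(1)] Pc[OF p_s(2)] Ph[OF p_s(1)] P[OF p_t(1)]])
        fix \<omega> assume \<omega>: "\<omega> \<in> space M" and "N t \<omega> = N s \<omega>"
        then show "\<bar>last_term cosh c (N t \<omega>) (\<lambda>j. S j \<omega>) t - last_term cosh c (N s \<omega>) (\<lambda>j. S j \<omega>) s -
            (t - s) * (c * last_term sinh c (N s \<omega>) (\<lambda>j. S j \<omega>) s)\<bar> \<le> K * (t - s)\<^sup>2"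
          using flow[OF bounds(1,2)[OF \<omega>]] last_term_flow(1)[of c "N s \<omega>" _ s "t - s", folded y_def] by simp
      next
        fix \<omega> assume \<omega>: "\<omega> \<in> space M" and N: "N t \<omega> = Suc (N s \<omega>)"
        show "\<bar>last_term cosh c (N t \<omega>) (\<lambda>j. S j \<omega>) t - last_term cosh c (N s \<omega>) (\<lambda>j. S j \<omega>) s -
            (- (1 / 2)) * last_term cosh c (N s \<omega>) (\<lambda>j. S j \<omega>) s\<bar> \<le> K * (t - s)"
          using jumps(1)[OF \<omega> \<omega> \<omega> \<omega> N] ey[of "last_term cosh c (N s \<omega>) (\<lambda>j. S j \<omega>) s"] bounds(1)[OF \<omega>] nonneg
          by (simp add: N abs_le_iff)
      qed
      then show ?thesis by (simp add: mean_last_def)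
    qed
    show "\<bar>mean_last sinh c t - mean_last sinh c s -
      (t - s) * (c * mean_last cosh c s - rate * mean_last sinh c s)\<bar> \<le> K' * (t - s)\<^sup>2"
    proof -
      have "\<bar>expectation (\<lambda>\<omega>. last_term sinh c (N t \<omega>) (\<lambda>j. S j \<omega>) t) -
          expectation (\<lambda>\<omega>. last_term sinh c (N s \<omega>) (\<lambda>j. S j \<omega>) s) -
          (t - s) * (expectation (\<lambda>\<omega>. c * last_term cosh c (N s \<omega>) (\<lambda>j. S j \<omega>) s) +
            rate * expectation (\<lambda>\<omega>. (- 1) * last_term sinh c (N s \<omega>) (\<lambda>j. S j \<omega>) s))\<bar>
        \<le> K' * (t - s)\<^sup>2"
        unfolding K'_def
      proof (rule expectation_increment[OF s st K P[OF p_s(2)] Pc[OF p_s(1)] Pm[OF p_s(2)] P[OF p_t(2)]])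
        fix \<omega> assume \<omega>: "\<omega> \<in> space M" and "N t \<omega> = N s \<omega>"
        then show "\<bar>last_term sinh c (N t \<omega>) (\<lambda>j. S j \<omega>) t - last_term sinh c (N s \<omega>) (\<lambda>j. S j \<omega>) s -
            (t - s) * (c * last_term cosh c (N s \<omega>) (\<lambda>j. S j \<omega>) s)\<bar> \<le> K * (t - s)\<^sup>2"
          using flow[OF bounds(2,1)[OF \<omega>]] last_term_flow(2)[of c "N s \<omega>" _ s "t - s", folded y_def] by simp
      next
        fix \<omega> assume \<omega>: "\<omega> \<in> space M" and N: "N t \<omega> = Suc (N s \<omega>)"
        show "\<bar>last_term sinh c (N t \<omega>) (\<lambda>j. S j \<omega>) t - last_term sinh c (N s \<omega>) (\<lambda>j. S j \<omega>) s -
            (- 1) * last_term sinh c (N s \<omega>) (\<lambda>j. S j \<omega>) s\<bar> \<le> K * (t - s)"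
          using jumps(2)[OF \<omega> \<omega> \<omega> \<omega> N] ey[of "last_term cosh c (N s \<omega>) (\<lambda>j. S j \<omega>) s"] bounds(1)[OF \<omega>] nonneg
          by (simp add: N)
      qed
      then show ?thesis by (simp add: mean_last_def)
    qed
    show "\<bar>mean_cm cosh c t - mean_cm cosh c s - (t - s) * (c * mean_cm sinh c s)\<bar> \<le> K' * (t - s)\<^sup>2"
    proof -
      have "\<bar>expectation (\<lambda>\<omega>. cm_term cosh c (N t \<omega>) (\<lambda>j. S j \<omega>) t) -
          expectation (\<lambda>\<omega>. cm_term cosh c (N s \<omega>) (\<lambda>j. S j \<omega>) s) -
          (t - s) * (expectation (\<lambda>\<omega>. c * cm_term sinh c (N s \<omega>) (\<lambda>j. S j \<omega>) s) +
            rate * expectation (\<lambda>\<omega>. 0))\<bar>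
        \<le> K' * (t - s)\<^sup>2"
        unfolding K'_def
      proof (rule expectation_increment[OF s st K P[OF p_s(3)] Pc[OF p_s(4)] P0 P[OF p_t(3)]])
        fix \<omega> assume \<omega>: "\<omega> \<in> space M" and "N t \<omega> = N s \<omega>"
        then show "\<bar>cm_term cosh c (N t \<omega>) (\<lambda>j. S j \<omega>) t - cm_term cosh c (N s \<omega>) (\<lambda>j. S j \<omega>) s -
            (t - s) * (c * cm_term sinh c (N s \<omega>) (\<lambda>j. S j \<omega>) s)\<bar> \<le> K * (t - s)\<^sup>2"
          using flow[OF bounds(3,4)[OF \<omega>]] cm_term_flow(1)[of c "N s \<omega>" _ s "t - s", folded y_def] by simp
      next
        fix \<omega> assume \<omega>: "\<omega> \<in> space M" and N: "N t \<omega> = Suc (N s \<omega>)"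
        show "\<bar>cm_term cosh c (N t \<omega>) (\<lambda>j. S j \<omega>) t - cm_term cosh c (N s \<omega>) (\<lambda>j. S j \<omega>) s - 0\<bar>
            \<le> K * (t - s)"
          using jumps(3)[OF \<omega> \<omega> \<omega> \<omega> N] ey[of "cm_term cosh c (N s \<omega>) (\<lambda>j. S j \<omega>) s"] bounds(3)[OF \<omega>] nonneg
          by (simp add: N)
      qed
      then show ?thesis by (simp add: mean_cm_def)
    qed
    show "\<bar>mean_cm sinh c t - mean_cm sinh c s -
      (t - s) * (c * mean_cm cosh c s - rate / 2 * mean_last sinh c s)\<bar> \<le> K' * (t - s)\<^sup>2"
    proof -
      have "\<bar>expectation (\<lambda>\<omega>. cm_term sinh c (N t \<omega>) (\<lambda>j. S j \<omega>) t) -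
          expectation (\<lambda>\<omega>. cm_term sinh c (N s \<omega>) (\<lambda>j. S j \<omega>) s) -
          (t - s) * (expectation (\<lambda>\<omega>. c * cm_term cosh c (N s \<omega>) (\<lambda>j. S j \<omega>) s) +
            rate * expectation (\<lambda>\<omega>. - (1 / 2) * last_term sinh c (N s \<omega>) (\<lambda>j. S j \<omega>) s))\<bar>
        \<le> K' * (t - s)\<^sup>2"
        unfolding K'_def
      proof (rule expectation_increment[OF s st K P[OF p_s(4)] Pc[OF p_s(3)] Ph[OF p_s(2)] P[OF p_t(4)]])
        fix \<omega> assume \<omega>: "\<omega> \<in> space M" and "N t \<omega> = N s \<omega>"
        then show "\<bar>cm_term sinh c (N t \<omega>) (\<lambda>j. S j \<omega>) t - cm_term sinh c (N s \<omega>) (\<lambda>j. S j \<omega>) s -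
            (t - s) * (c * cm_term cosh c (N s \<omega>) (\<lambda>j. S j \<omega>) s)\<bar> \<le> K * (t - s)\<^sup>2"
          using flow[OF bounds(4,3)[OF \<omega>]] cm_term_flow(2)[of c "N s \<omega>" _ s "t - s", folded y_def] by simp
      next
        fix \<omega> assume \<omega>: "\<omega> \<in> space M" and N: "N t \<omega> = Suc (N s \<omega>)"
        show "\<bar>cm_term sinh c (N t \<omega>) (\<lambda>j. S j \<omega>) t - cm_term sinh c (N s \<omega>) (\<lambda>j. S j \<omega>) s -
            (- (1 / 2)) * last_term sinh c (N s \<omega>) (\<lambda>j. S j \<omega>) s\<bar> \<le> K * (t - s)"
          using jumps(4)[OF \<omega> \<omega> \<omega> \<omega> N] ey[of "cm_term cosh c (N s \<omega>) (\<lambda>j. S j \<omega>) s"] bounds(3)[OF \<omega>] nonneg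
          by (simp add: N abs_le_iff)
      qed
      then show ?thesis by (simp add: mean_cm_def mean_last_def)
    qed
  qed
  show ?th1 using main(1) by blast
  show ?th2 using main(2) by blast
  show ?th3 using main(3) by blast
  show ?th4 using main(4) by blast
qed

end

section \<open>The Cauchy problem\<close>

definition cm_source :: "real \<Rightarrow> real \<Rightarrow> real \<Rightarrow> real" where
  "cm_source c lam t = lam * c\<^sup>2 * exp (- (3 / 4) * lam * t) / sqrt (lam\<^sup>2 + 16 * c\<^sup>2)
     * (exp (- (t / 4) * sqrt (lam\<^sup>2 + 16 * c\<^sup>2)) - exp (t / 4 * sqrt (lam\<^sup>2 + 16 * c\<^sup>2)))"

lemma solves_cauchy_problemI:
  assumes "\<And>t. 0 \<le> t \<Longrightarrow> (v has_real_derivative v' t) (at t within {0..})"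
    and "\<And>t. 0 \<le> t \<Longrightarrow> (v' has_real_derivative c\<^sup>2 * v t + cm_source c lam t) (at t within {0..})"
    and "v 0 = 1" "v' 0 = 0"
  shows "solves_cauchy_problem c lam v"
  unfolding solves_cauchy_problem_def
  using assms by (intro exI[of _ v'] exI[of _ "\<lambda>t. c\<^sup>2 * v t + cm_source c lam t"]) (auto simp: cm_source_def)

text \<open>
  This representation gives uniqueness, and, being continuous in the rate, it also identifies the
  limit of \<^const>\<open>u_formula\<close> at the exceptional rate \<open>3 * c\<close>.
\<close>

lemma solves_cauchy_problem_duhamel:
  assumes "solves_cauchy_problem c lam v" "0 \<le> t"
  shows "c * v t = c * cosh (c * t) + integral {0..t} (\<lambda>s. cm_source c lam s * sinh (c * (t - s)))"
proof -
  obtain v' v'' where d: "\<And>t. 0 \<le> t \<Longrightarrow> (v has_real_derivative v' t) (at t within {0..})"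
      "\<And>t. 0 \<le> t \<Longrightarrow> (v' has_real_derivative v'' t) (at t within {0..})"
    and eq: "\<And>t. 0 \<le> t \<Longrightarrow> v'' t - c\<^sup>2 * v t = cm_source c lam t" and init: "v 0 = 1" "v' 0 = 0"
    using assms(1) unfolding solves_cauchy_problem_def cm_source_def by blast
  \<comment> \<open>The Wronskian of \<open>v\<close> and the homogeneous solution
    \<open>sinh (c * (t - s))\<close> in the variable \<open>s\<close>. It equals
    \<open>c * v t\<close> at \<open>s = t\<close> and \<open>c * cosh (c * t)\<close> at
    \<open>s = 0\<close>.\<close>
  define g where "g s = v' s * sinh (c * (t - s)) + c * v s * cosh (c * (t - s))" for s
  have "(g has_vector_derivative cm_source c lam s * sinh (c * (t - s))) (at s within {0..t})"
    if "s \<in> {0..t}" for s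
  proof -
    have s: "0 \<le> s" and sub: "{0..t} \<subseteq> {0..}" using that by auto
    have "(g has_real_derivative (v'' s - c\<^sup>2 * v s) * sinh (c * (t - s))) (at s within {0..t})"
      unfolding g_def
      by (rule derivative_eq_intros DERIV_subset[OF d(1)[OF s] sub] DERIV_subset[OF d(2)[OF s] sub] refl)+
         (simp add: algebra_simps power2_eq_square)
    then show ?thesis using eq[OF s] by (simp add: has_real_derivative_iff_has_vector_derivative)
  qed
  then have "((\<lambda>s. cm_source c lam s * sinh (c * (t - s))) has_integral g t - g 0) {0..t}"
    by (intro fundamental_theorem_of_calculus assms(2)) auto
  then have "integral {0..t} (\<lambda>s. cm_source c lam s * sinh (c * (t - s))) = g t - g 0"
    by (rule integral_unique)
  then show ?thesis by (simp add: g_def init)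
qed

text \<open>The only denominator in the integrand is the square root, which is positive for every
  rate; nothing is singular at \<open>3 * c\<close>.\<close>

lemma duhamel_continuous_in_rate:
  assumes "0 < c"
  shows "isCont (\<lambda>l. integral {0..t} (\<lambda>s. cm_source c l s * sinh (c * (t - s)))) l0"
proof -
  have pos: "sqrt (l\<^sup>2 + 16 * c\<^sup>2) \<noteq> 0" for l
    using assms by (simp add: add_nonneg_eq_0_iff)
  have "continuous_on (UNIV \<times> cbox 0 t) (\<lambda>(l, s). cm_source c l s * sinh (c * (t - s)))"
    unfolding cm_source_def case_prod_beta
    by (intro continuous_intros) (use pos in auto)
  from integral_continuous_on_param[OF this]
  show ?thesis by (simp add: continuous_on_eq_continuous_at)
qed

lemma exponential_ode_unique:
  fixes f :: "real \<Rightarrow> real"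
  assumes "\<And>t. 0 \<le> t \<Longrightarrow> (f has_real_derivative k * f t) (at t within {0..})" "0 \<le> t"
  shows "f t = f 0 * exp (k * t)"
proof -
  have "((\<lambda>t. f t * exp (- (k * t))) has_real_derivative 0) (at t within {0..})" if "0 \<le> t" for t
    by (rule derivative_eq_intros assms(1)[OF that] refl)+ (simp add: algebra_simps)
  then obtain C where C: "\<And>t. 0 \<le> t \<Longrightarrow> f t * exp (- (k * t)) = C"
    using has_field_derivative_zero_constant[of "{0..}" "\<lambda>t. f t * exp (- (k * t))"] by auto
  have "f t * exp (- (k * t)) = f 0" using C[of t] C[of 0] assms(2) by simp
  then show ?thesis by (simp add: exp_minus field_simps)
qed

lemma u_formula_solves:
  assumes "0 < c" "0 < lam" "lam \<noteq> 3 * c"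
  shows "solves_cauchy_problem c lam (u_formula c lam)"
proof -
  define R where "R = sqrt (lam\<^sup>2 + 16 * c\<^sup>2)"
  have R2: "R\<^sup>2 = lam\<^sup>2 + 16 * c\<^sup>2" by (simp add: R_def)
  have R: "0 < R" using assms by (simp add: R_def add_pos_pos)
  define P Q where "P = 3 * R + 5 * lam" and "Q = 3 * R - 5 * lam"
  \<comment> \<open>All critical denominators are controlled by \<open>E\<close>: it is a multiple
    of both \<open>P * Q\<close> and \<open>(lam + 3 * c) * (lam - 3 * c)\<close>, so
    \<open>3 * c\<close> is the only positive rate at which one vanishes.\<close>
  define E where "E = 9 * c\<^sup>2 - lam\<^sup>2"
  have PQ: "P * Q = 16 * E"
    using R2 by (simp add: P_def Q_def E_def algebra_simps power2_eq_square)
  have E_fac: "E = - (lam + 3 * c) * (lam - 3 * c)" by (simp add: E_def algebra_simps power2_eq_square)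
  have E: "E \<noteq> 0" using assms by (simp add: E_fac)
  then have P: "P \<noteq> 0" and Q: "Q \<noteq> 0" using PQ by auto
  \<comment> \<open>The eigenvalues of the linear system for \<open>C\<close> and \<open>D\<close>,
    hence the exponents of the source.\<close>
  define m1 m2 where "m1 = - (3 / 4) * lam - R / 4" and "m2 = - (3 / 4) * lam + R / 4"
  have exps: "exp (m1 * t) = exp (- (3 / 4) * lam * t) * exp (- (t / 4) * R)"
    "exp (m2 * t) = exp (- (3 / 4) * lam * t) * exp (t / 4 * R)" for t
    unfolding m1_def m2_def by (simp_all add: algebra_simps flip: exp_add)
  define A1 A2 A3 A4 where "A1 = 8 * c\<^sup>2 / (R * P)" and "A2 = 8 * c\<^sup>2 / (R * Q)"
    and "A3 = (lam + 2 * c) / (2 * (lam + 3 * c))" and "A4 = (lam - 2 * c) / (2 * (lam - 3 * c))"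
  have u: "u_formula c lam t = A1 * exp (m1 * t) + A2 * exp (m2 * t) + A3 * exp (c * t) + A4 * exp (- c * t)" for t
    unfolding exps u_formula_def R_def[symmetric] P_def[symmetric] Q_def[symmetric] A1_def A2_def A3_def A4_def
    by (simp add: distrib_left)
  have f: "cm_source c lam t = lam * c\<^sup>2 / R * (exp (m1 * t) - exp (m2 * t))" for t
    unfolding exps cm_source_def R_def[symmetric] by (simp add: right_diff_distrib)
  \<comment> \<open>These identities explain \<open>P\<close> and \<open>Q\<close> in the formula:
    the response to a source term with exponent \<open>m\<close> has its coefficient divided by
    \<open>m\<^sup>2 - c\<^sup>2\<close>.\<close>
  have m: "m1\<^sup>2 - c\<^sup>2 = lam * P / 8" "m2\<^sup>2 - c\<^sup>2 = - lam * Q / 8"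
    using R2 unfolding m1_def m2_def P_def Q_def by (simp_all add: field_simps power2_eq_square)
  have eq1: "m1\<^sup>2 * A1 = c\<^sup>2 * A1 + lam * c\<^sup>2 / R"
  proof -
    have "(m1\<^sup>2 - c\<^sup>2) * A1 = lam * c\<^sup>2 / R" unfolding m A1_def using P R by simp
    then show ?thesis by (simp add: algebra_simps)
  qed
  have eq2: "m2\<^sup>2 * A2 = c\<^sup>2 * A2 - lam * c\<^sup>2 / R"
  proof -
    have "(m2\<^sup>2 - c\<^sup>2) * A2 = - (lam * c\<^sup>2 / R)" unfolding m A2_def using Q R by simp
    then show ?thesis by (simp add: algebra_simps)
  qed
  \<comment> \<open>The initial data involve the four coefficients only through these sums and
    differences, in which \<open>P\<close> and \<open>Q\<close> enter by way of
    \<open>P * Q\<close>, \<open>P + Q\<close> and \<open>P - Q\<close>.\<close>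
  have sum12: "A1 + A2 = 3 * c\<^sup>2 / E" and diff12: "A2 - A1 = 5 * lam * c\<^sup>2 / (R * E)"
  proof -
    have "A1 + A2 = 8 * c\<^sup>2 * (P + Q) / (R * (P * Q))" "A2 - A1 = 8 * c\<^sup>2 * (P - Q) / (R * (P * Q))"
      unfolding A1_def A2_def using P Q R by (simp_all add: field_simps)
    moreover have "P + Q = 6 * R" "P - Q = 10 * lam" by (simp_all add: P_def Q_def)
    ultimately show "A1 + A2 = 3 * c\<^sup>2 / E" "A2 - A1 = 5 * lam * c\<^sup>2 / (R * E)"
      unfolding PQ using R E by (simp_all add: field_simps)
  qed
  have sum34: "A3 + A4 = (6 * c\<^sup>2 - lam\<^sup>2) / E" and diff34: "A3 - A4 = c * lam / E"
  proof -
    have "lam + 3 * c \<noteq> 0" "lam - 3 * c \<noteq> 0" using assms by auto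
    then show "A3 + A4 = (6 * c\<^sup>2 - lam\<^sup>2) / E" "A3 - A4 = c * lam / E"
      unfolding A3_def A4_def E_fac by (simp_all add: divide_simps) (simp_all add: algebra_simps power2_eq_square)
  qed
  define u' where "u' t = A1 * m1 * exp (m1 * t) + A2 * m2 * exp (m2 * t)
    + A3 * c * exp (c * t) - A4 * c * exp (- c * t)" for t
  show ?thesis
  proof (rule solves_cauchy_problemI)
    fix t :: real
    show "(u_formula c lam has_real_derivative u' t) (at t within {0..})"
      unfolding u u'_def by (rule derivative_eq_intros refl)+ (simp add: algebra_simps)
    have "(u' has_real_derivative m1\<^sup>2 * A1 * exp (m1 * t) + m2\<^sup>2 * A2 * exp (m2 * t)
        + c\<^sup>2 * A3 * exp (c * t) + c\<^sup>2 * A4 * exp (- c * t)) (at t within {0..})"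
      unfolding u'_def by (rule derivative_eq_intros refl)+ (simp add: algebra_simps power2_eq_square)
    then show "(u' has_real_derivative c\<^sup>2 * u_formula c lam t + cm_source c lam t) (at t within {0..})"
      unfolding u f eq1 eq2 by (simp add: algebra_simps diff_divide_distrib)
  next
    have "u_formula c lam 0 = (A1 + A2) + (A3 + A4)" by (simp add: u)
    also have "\<dots> = E / E" unfolding sum12 sum34 by (simp add: E_def flip: add_divide_distrib)
    finally show "u_formula c lam 0 = 1" using E by simp
    have "u' 0 = - (3 / 4) * lam * (A1 + A2) + R / 4 * (A2 - A1) + c * (A3 - A4)"
      by (simp add: u'_def m1_def m2_def field_simps)
    also have "\<dots> = 0" unfolding sum12 diff12 diff34 using R E by (simp add: field_simps power2_eq_square)
    finally show "u' 0 = 0" .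
  qed
qed

context poisson_process
begin

lemma mean_at_0:
  "mean_last f c 0 = f 0" "mean_cm f c 0 = f 0"
  unfolding mean_last_def mean_cm_def
  by (simp_all add: N_0 event_time_0 last_term_def cm_term_def prob_space cong: Bochner_Integration.integral_cong)

lemma mean_odes:
  assumes c: "0 < c" and t: "0 \<le> t"
  shows "(mean_last cosh c has_real_derivative c * mean_last sinh c t - rate / 2 * mean_last cosh c t)
      (at t within {0..})"
    "(mean_last sinh c has_real_derivative c * mean_last cosh c t - rate * mean_last sinh c t)
      (at t within {0..})"
    "(mean_cm cosh c has_real_derivative c * mean_cm sinh c t) (at t within {0..})"
    "(mean_cm sinh c has_real_derivative c * mean_cm cosh c t - rate / 2 * mean_last sinh c t)
      (at t within {0..})"
proof -
  have c': "0 < 1 / c" using c by simp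
  note mb = mean_bound[OF less_imp_le[OF c]]
  have lin: "\<exists>B. \<forall>s. 0 \<le> s \<longrightarrow> s \<le> T \<longrightarrow> \<bar>a * p s - b * q s\<bar> \<le> B"
    if "\<And>s. 0 \<le> s \<Longrightarrow> s \<le> T \<Longrightarrow> \<bar>p s\<bar> \<le> B" "\<And>s. 0 \<le> s \<Longrightarrow> s \<le> T \<Longrightarrow> \<bar>q s\<bar> \<le> B"
    for a b B T :: real and p q :: "real \<Rightarrow> real"
  proof (intro exI allI impI)
    fix s assume s: "0 \<le> s" "s \<le> T"
    have "\<bar>a * p s - b * q s\<bar> \<le> \<bar>a\<bar> * \<bar>p s\<bar> + \<bar>b\<bar> * \<bar>q s\<bar>"
      by (metis abs_mult abs_triangle_ineq4)
    also have "\<dots> \<le> \<bar>a\<bar> * B + \<bar>b\<bar> * B" using that s by (intro add_mono mult_left_mono) auto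
    finally show "\<bar>a * p s - b * q s\<bar> \<le> \<bar>a\<bar> * B + \<bar>b\<bar> * B" .
  qed
  \<comment> \<open>The zero multiple in the third line gives it the shape required by
    \<open>lin\<close>; it is simplified away afterwards.\<close>
  have bdd:
    "\<exists>B. \<forall>s. 0 \<le> s \<longrightarrow> s \<le> T \<longrightarrow> \<bar>c * mean_last sinh c s - rate / 2 * mean_last cosh c s\<bar> \<le> B"
    "\<exists>B. \<forall>s. 0 \<le> s \<longrightarrow> s \<le> T \<longrightarrow> \<bar>c * mean_last cosh c s - rate * mean_last sinh c s\<bar> \<le> B"
    "\<exists>B. \<forall>s. 0 \<le> s \<longrightarrow> s \<le> T \<longrightarrow> \<bar>c * mean_cm sinh c s - 0 * mean_cm sinh c s\<bar> \<le> B"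
    "\<exists>B. \<forall>s. 0 \<le> s \<longrightarrow> s \<le> T \<longrightarrow> \<bar>c * mean_cm cosh c s - rate / 2 * mean_last sinh c s\<bar> \<le> B" for T
    by (rule lin[OF mb(2) mb(1)] lin[OF mb(1) mb(2)] lin[OF mb(4) mb(4)] lin[OF mb(3) mb(2)]; assumption)+
  \<comment> \<open>Odd-numbered facts are the continuity statements and even-numbered ones the
    derivatives; the continuity of all four means precedes any derivative.\<close>
  note der = has_derivative_of_quadratic_increment[OF c' mean_increments(1)[OF c] bdd(1)]
    has_derivative_of_quadratic_increment[OF c' mean_increments(2)[OF c] bdd(2)]
    has_derivative_of_quadratic_increment[OF c' mean_increments(3)[OF c] bdd(3)[simplified]]
    has_derivative_of_quadratic_increment[OF c' mean_increments(4)[OF c] bdd(4)]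
  show "(mean_last cosh c has_real_derivative c * mean_last sinh c t - rate / 2 * mean_last cosh c t)
      (at t within {0..})"
    by (rule der(2)[OF _ t]) (intro continuous_intros der(1,3))
  show "(mean_last sinh c has_real_derivative c * mean_last cosh c t - rate * mean_last sinh c t)
      (at t within {0..})"
    by (rule der(4)[OF _ t]) (intro continuous_intros der(1,3))
  show "(mean_cm cosh c has_real_derivative c * mean_cm sinh c t) (at t within {0..})"
    by (rule der(6)[OF _ t]) (intro continuous_intros der(7))
  show "(mean_cm sinh c has_real_derivative c * mean_cm cosh c t - rate / 2 * mean_last sinh c t)
      (at t within {0..})"
    by (rule der(8)[OF _ t]) (intro continuous_intros der(3,5))
qed

text \<open>For each eigenvalue \<open>m\<close>, the row \<open>(m + rate, c)\<close> is a left
  eigenvector of the system, so that combination of the means is a pure exponential, with initial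
  value \<open>m + rate\<close> since \<open>C\<close> starts at 1 and \<open>D\<close> at
  0.\<close>

lemma mean_last_sinh_eq:
  assumes c: "0 < c" and t: "0 \<le> t"
  defines "R \<equiv> sqrt (rate\<^sup>2 + 16 * c\<^sup>2)"
  shows "mean_last sinh c t =
    2 * c / R * exp (- (3 / 4) * rate * t) * (exp (t / 4 * R) - exp (- (t / 4) * R))"
proof -
  have R2: "R\<^sup>2 = rate\<^sup>2 + 16 * c\<^sup>2" by (simp add: R_def)
  have R: "0 < R" using c by (simp add: R_def add_nonneg_pos)
  define m1 m2 where "m1 = - (3 / 4) * rate - R / 4" and "m2 = - (3 / 4) * rate + R / 4"
  have left_eigenvector: "(m + rate) * mean_last cosh c t + c * mean_last sinh c t = (m + rate) * exp (m * t)"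
    if m: "m\<^sup>2 + 3 / 2 * rate * m + rate\<^sup>2 / 2 - c\<^sup>2 = 0" for m
  proof -
    have m': "(m + rate) * (- (rate / 2)) + c * c = m * (m + rate)"
      using m by (simp add: field_simps power2_eq_square)
    have "((\<lambda>t. (m + rate) * mean_last cosh c t + c * mean_last sinh c t) has_real_derivative
        m * ((m + rate) * mean_last cosh c t + c * mean_last sinh c t)) (at t within {0..})"
      if "0 \<le> t" for t
    proof -
      have "((\<lambda>t. (m + rate) * mean_last cosh c t + c * mean_last sinh c t) has_real_derivative
        ((m + rate) * (- (rate / 2)) + c * c) * mean_last cosh c t + m * (c * mean_last sinh c t)) (at t within {0..})"
        by (rule derivative_eq_intros mean_odes[OF c that] refl)+ (simp add: algebra_simps)
      then show ?thesis unfolding m' by (simp add: algebra_simps)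
    qed
    from exponential_ode_unique[OF this t] show ?thesis by (simp add: mean_at_0)
  qed
  have roots: "m1\<^sup>2 + 3 / 2 * rate * m1 + rate\<^sup>2 / 2 - c\<^sup>2 = 0" "m2\<^sup>2 + 3 / 2 * rate * m2 + rate\<^sup>2 / 2 - c\<^sup>2 = 0"
    using R2 unfolding m1_def m2_def by (simp_all add: field_simps power2_eq_square)
  \<comment> \<open>The characteristic polynomial evaluated at \<open>- rate\<close>.\<close>
  have prod: "(m1 + rate) * (m2 + rate) = - c\<^sup>2"
    using R2 unfolding m1_def m2_def by (simp add: field_simps power2_eq_square)
  \<comment> \<open>Eliminates the cosh mean between the two eigenvector relations.\<close>
  have "c * ((m2 - m1) * mean_last sinh c t) =
      (m2 + rate) * ((m1 + rate) * mean_last cosh c t + c * mean_last sinh c t) -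
      (m1 + rate) * ((m2 + rate) * mean_last cosh c t + c * mean_last sinh c t)"
    by (simp add: algebra_simps)
  also have "\<dots> = ((m1 + rate) * (m2 + rate)) * (exp (m1 * t) - exp (m2 * t))"
    unfolding left_eigenvector[OF roots(1)] left_eigenvector[OF roots(2)] by (simp add: algebra_simps)
  also have "\<dots> = c * (c * (exp (m2 * t) - exp (m1 * t)))"
    unfolding prod by (simp add: algebra_simps power2_eq_square)
  also have "m2 - m1 = R / 2" by (simp add: m1_def m2_def)
  finally have "c * (R / 2 * mean_last sinh c t) = c * (c * (exp (m2 * t) - exp (m1 * t)))" .
  then have "R / 2 * mean_last sinh c t = c * (exp (m2 * t) - exp (m1 * t))"
    using c by (subst (asm) mult_cancel_left) simp
  then have "mean_last sinh c t = 2 * c / R * (exp (m2 * t) - exp (m1 * t))"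
    using R by (simp add: field_simps)
  also have "exp (m2 * t) = exp (- (3 / 4) * rate * t) * exp (t / 4 * R)"
    by (simp add: m2_def algebra_simps flip: exp_add)
  also have "exp (m1 * t) = exp (- (3 / 4) * rate * t) * exp (- (t / 4) * R)"
    by (simp add: m1_def algebra_simps flip: exp_add)
  finally show ?thesis by (simp add: right_diff_distrib mult.assoc)
qed

lemma cosh_eta_cm_eq: "cosh (eta_cm c N S t \<omega>) = cm_term cosh c (N t \<omega>) (\<lambda>j. S j \<omega>) t"
  unfolding cosh_eta_cm cosh_eta cm_term_def last_term_def leg_prod_def by simp

lemma mean_cosh_cm_eq: "mean_cosh_cm M c N S = mean_cm cosh c"
  by (simp add: fun_eq_iff mean_cosh_cm_def mean_cm_def cosh_eta_cm_eq)

lemma integrable_cosh_eta_cm: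
  assumes "0 \<le> c" "0 \<le> t"
  shows "integrable M (\<lambda>\<omega>. cosh (eta_cm c N S t \<omega>))"
  unfolding cosh_eta_cm_eq
  by (rule past_functional_measurable(2)[OF past_functional_terms(3)[OF assms(1) order_refl] assms(2)])

lemma mean_cosh_cm_solves:
  assumes "0 < c"
  shows "solves_cauchy_problem c rate (mean_cosh_cm M c N S)"
  unfolding mean_cosh_cm_eq
proof (rule solves_cauchy_problemI)
  fix t :: real assume t: "0 \<le> t"
  show "(mean_cm cosh c has_real_derivative c * mean_cm sinh c t) (at t within {0..})"
    by (rule mean_odes(3)[OF assms t])
  have "((\<lambda>t. c * mean_cm sinh c t) has_real_derivative
      c * (c * mean_cm cosh c t - rate / 2 * mean_last sinh c t)) (at t within {0..})"
    by (intro DERIV_cmult mean_odes(4)[OF assms t])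
  moreover have "c * (c * mean_cm cosh c t - rate / 2 * mean_last sinh c t) =
      c\<^sup>2 * mean_cm cosh c t + cm_source c rate t"
    unfolding mean_last_sinh_eq[OF assms t] cm_source_def by (simp add: algebra_simps power2_eq_square)
  ultimately show "((\<lambda>t. c * mean_cm sinh c t) has_real_derivative
      c\<^sup>2 * mean_cm cosh c t + cm_source c rate t) (at t within {0..})" by simp
qed (simp_all add: mean_at_0)

end

theorem theorem5p2:
  fixes M :: "'a measure" and N :: "real \<Rightarrow> 'a \<Rightarrow> nat" and S :: "nat \<Rightarrow> 'a \<Rightarrow> real"
    and c lam :: real
  assumes "0 < c" and "0 < lam" and "poisson_process M lam N S"
  shows "(\<forall>t\<ge>0. integrable M (\<lambda>\<omega>. cosh (eta_cm c N S t \<omega>))) \<and>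
    (lam \<noteq> 3 * c \<longrightarrow> (\<forall>t\<ge>0. mean_cosh_cm M c N S t = u_formula c lam t)) \<and>
    (lam = 3 * c \<longrightarrow>
      (\<forall>t\<ge>0. ((\<lambda>l. u_formula c l t) \<longlongrightarrow> mean_cosh_cm M c N S t) (at (3 * c)))) \<and>
    solves_cauchy_problem c lam (mean_cosh_cm M c N S) \<and>
    (\<forall>v. solves_cauchy_problem c lam v \<longrightarrow> (\<forall>t\<ge>0. v t = mean_cosh_cm M c N S t))"
proof -
  interpret poisson_process M lam N S by (rule assms(3))
  note solves = mean_cosh_cm_solves[OF assms(1)]
  \<comment> \<open>The value forced on any solution, for every rate \<open>l\<close>. The process
    is given only at rate \<open>lam\<close>, so the limit in the rate is taken along
    \<open>w\<close>, which agrees with \<open>u_formula\<close> near \<open>3 * c\<close> and with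
    the mean at \<open>lam\<close>.\<close>
  define w where "w l t = (c * cosh (c * t) + integral {0..t} (\<lambda>s. cm_source c l s * sinh (c * (t - s)))) / c"
    for l t
  have w: "v t = w l t" if "solves_cauchy_problem c l v" "0 \<le> t" for v l t
    using solves_cauchy_problem_duhamel[OF that] assms(1) by (simp add: w_def field_simps)
  have unique: "v t = mean_cosh_cm M c N S t" if "solves_cauchy_problem c lam v" "0 \<le> t" for v t
    using w[OF that] w[OF solves that(2)] by simp
  have limit: "((\<lambda>l. u_formula c l t) \<longlongrightarrow> mean_cosh_cm M c N S t) (at (3 * c))"
    if "lam = 3 * c" "0 \<le> t" for t
  proof -
    have "isCont (\<lambda>l. w l t) (3 * c)"
      unfolding w_def using assms(1) by (intro continuous_intros duhamel_continuous_in_rate) auto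
    then have "((\<lambda>l. w l t) \<longlongrightarrow> mean_cosh_cm M c N S t) (at (3 * c))"
      using w[OF solves that(2)] that(1) by (simp add: isCont_def)
    moreover have "\<forall>\<^sub>F l in at (3 * c). u_formula c l t = w l t"
    proof -
      have "\<forall>\<^sub>F l in at (3 * c). 0 < l \<and> l \<noteq> 3 * c"
        using assms(1) order_tendstoD(1)[OF tendsto_ident_at, of 0 "3 * c" UNIV]
        by (auto simp: eventually_conj_iff eventually_at_filter)
      then show ?thesis
        by eventually_elim (use w[OF u_formula_solves that(2)] assms(1) in blast)
    qed
    ultimately show ?thesis by (simp add: tendsto_cong)
  qed
  show ?thesis
  proof (intro conjI allI impI)
    show "integrable M (\<lambda>\<omega>. cosh (eta_cm c N S t \<omega>))" if "0 \<le> t" for t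
      using assms(1) that by (intro integrable_cosh_eta_cm) auto
    show "mean_cosh_cm M c N S t = u_formula c lam t" if "lam \<noteq> 3 * c" "0 \<le> t" for t
      by (rule unique[OF u_formula_solves[OF assms(1,2) that(1)] that(2), symmetric])
  qed (fact limit solves unique)+
qed

end
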